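(* For $n\in\mathbb{Z}_{>0}$ and $0\le r\le n$ write $P^{(C_n)}_{(1^r)}=P_{(1^r)}(x\,|\,a,-a,c,-c\,|\,q,t)$ for the Koornwinder polynomial in $x=(x_1,\dots,x_n)$ with one-column diagram $(1^r)$, and let $\mathbf{P}^{(n)}$, $\mathbf{m}^{(n)}$ be the infinite column vectors (with entries indexed by $0,1,2,\dots$) $$\mathbf{P}^{(n)}={}^t\big(P^{(C_n)}_{(1^{n})},\ldots,P^{(C_n)}_{(1)},P^{(C_n)}_{\varnothing},0,0,0,\ldots\big),\qquad \mathbf{m}^{(n)}={}^t\big(m_{(1^{n})},\ldots,m_{(1)},m_{\varnothing},0,0,0,\ldots\big).$$ There exists a unique infinite matrix $\mathcal{C}=(\mathcal{C}_{ij})_{i,j\in\mathbb{Z}_{\ge 0}}$ satisfying the conditions: (a) $\mathcal{C}$ is upper triangular: $i>j$ implies $\mathcal{C}_{ij}=0$; (b) $\mathcal{C}$ is even: $i+j$ odd implies $\mathcal{C}_{ij}=0$; (c) (stability) the $\mathcal{C}_{ij}$ are rational functions in $a$, $c$ and $t$ which do not depend on $n$, and $\mathbf{P}^{(n)}=\mathcal{C}\,\mathbf{m}^{(n)}$ for all $n\ge 1$. Moreover, this matrix $\mathcal{C}$ is uniquely characterized (among even upper triangular matrices) by the recursion relations $$\mathcal{C}_{0,0}=1,\qquad \mathcal{C}_{i-1,i-1}=\mathcal{C}_{i,i}\quad (i=1,2,3,\ldots),$$ $$f(t)\,\mathcal{C}_{1,j-1}=\mathcal{C}_{0,j}\quad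 (j=2,4,6,\ldots),$$ $$\mathcal{C}_{i-1,j-1}+f\big(t^{i+1}\big)\,\mathcal{C}_{i+1,j-1}=\mathcal{C}_{i,j}\quad (i+j\ \text{even},\ 0<i<j),$$ where $$f(s)=\frac{(1-1/s)\big(1-t^{2}/(s a^2c^2)\big)\big(1+t/(s a^2)\big)\big(1+t/(sc^2)\big)}{\big(1-t/(s^{2}a^2c^2)\big)\big(1-t^{3}/(s^{2}a^2c^2)\big)}.$$
   Context: Koornwinder polynomials. Let $n\ge1$, $x=(x_1,\dots,x_n)$, and let $a,b,c,d,q,t$ be generic complex parameters, $|q|<1$; put $\alpha=(abcd/q)^{1/2}$. The group $W_n=\mathbb{Z}_2^n\rtimes\mathfrak{S}_n$ acts on Laurent polynomials by permuting the variables and inverting $x_i\mapsto x_i^{-1}$. For a partition $\lambda=(\lambda_1\ge\dots\ge\lambda_n\ge0)$, $m_\lambda=m_\lambda(x)$ is the sum of the distinct monomials $x^\mu$, $\mu$ in the $W_n$-orbit of $\lambda$. Let $T_{q,x_i}^{\pm1}$ replace $x_i$ by $q^{\pm1}x_i$, and set $$\mathcal{D}_x=\sum_{i=1}^n\frac{(1-ax_i)(1-bx_i)(1-cx_i)(1-dx_i)}{\alpha t^{n-1}(1-x_i^2)(1-qx_i^2)}\prod_{j\ne i}\frac{(1-tx_ix_j)(1-tx_i/x_j)}{(1-x_ix_j)(1-x_i/x_j)}\big(T_{q,x_i}-1\big)$$ $$\qquad+\sum_{i=1}^n\frac{(1-a/x_i)(1-b/x_i)(1-c/x_i)(1-d/x_i)}{\alpha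 t^{n-1}(1-1/x_i^2)(1-q/x_i^2)}\prod_{j\ne i}\frac{(1-tx_j/x_i)(1-t/(x_ix_j))}{(1-x_j/x_i)(1-1/(x_ix_j))}\big(T_{q,x_i}^{-1}-1\big).$$ The Koornwinder polynomial $P_\lambda(x)=P_\lambda(x\,|\,a,b,c,d\,|\,q,t)$ is the unique $W_n$-invariant Laurent polynomial with $P_\lambda=m_\lambda+$ (linear combination of $m_\mu$, $\mu<\lambda$ in dominance order: $\mu_1+\dots+\mu_i\le\lambda_1+\dots+\lambda_i$ for all $i$) and $\mathcal{D}_xP_\lambda=d_\lambda P_\lambda$, where $d_\lambda=\sum_{j=1}^n\big(\alpha t^{n-j}q^{\lambda_j}+\alpha^{-1}t^{-n+j}q^{-\lambda_j}-\alpha t^{n-j}-\alpha^{-1}t^{-n+j}\big)$. Here $(1^r)$ is the partition with $r$ parts equal to $1$, $(1^0)=\varnothing$, and $m_\varnothing=P_\varnothing=1$. The values $f(t^{i+1})$ are regarded as rational functions in $a,c,t$. *)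

theory Defs
  imports
    Complex_Main
    "HOL-Library.Poly_Mapping"
    "HOL-Computational_Algebra.Polynomial"
    "HOL-Computational_Algebra.Fraction_Field"
    "HOL-Combinatorics.Permutations"
begin

section \<open>Laurent polynomials and their field of fractions\<close>

text \<open>
  An exponent vector \<open>\<mu> :: nat \<Rightarrow>\<^sub>0 int\<close> stands for the Laurent monomial
  \<open>x\<^sup>\<mu>\<close>; in \<open>n\<close> variables only the indices \<open>1, \<dots>, n\<close> are used.
  Laurent polynomials are formal (finitely supported coefficient families), and identities
  between rational functions of \<open>x\<close> are identities in the fraction field.
\<close>

type_synonym exponent = "nat \<Rightarrow>\<^sub>0 int"
type_synonym laurent = "exponent \<Rightarrow>\<^sub>0 complex"

definition const_laurent :: "complex \<Rightarrow> laurent" where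
  "const_laurent z = Poly_Mapping.single 0 z"

definition emb :: "laurent \<Rightarrow> laurent fract" where
  "emb p = Fract p 1"

definition cst :: "complex \<Rightarrow> laurent fract" where
  "cst z = emb (const_laurent z)"

definition Xvar :: "nat \<Rightarrow> laurent fract" where
  "Xvar i = emb (Poly_Mapping.single (Poly_Mapping.single i 1) 1)"

definition laurent_in :: "nat \<Rightarrow> laurent \<Rightarrow> bool" where
  "laurent_in n p \<longleftrightarrow> (\<forall>\<mu>\<in>Poly_Mapping.keys p. Poly_Mapping.keys \<mu> \<subseteq> {1..n})"

text \<open>The substitution \<open>x\<^sub>i \<mapsto> u x\<^sub>i\<close>.\<close>

definition scale_var :: "complex \<Rightarrow> nat \<Rightarrow> laurent \<Rightarrow> laurent" where
  "scale_var u i p = Poly_Mapping.mapp (\<lambda>\<mu> z. u powi (Poly_Mapping.lookup \<mu> i) * z) p"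


section \<open>The hyperoctahedral group and orbit sums\<close>

text \<open>\<open>\<mu>\<close> and \<open>\<nu>\<close> lie in the same orbit of \<open>W\<^sub>n\<close> (signed permutations of
  the entries with indices \<open>1, \<dots>, n\<close>).\<close>

definition weyl_conj :: "nat \<Rightarrow> exponent \<Rightarrow> exponent \<Rightarrow> bool" where
  "weyl_conj n \<mu> \<nu> \<longleftrightarrow>
     (\<exists>\<sigma> (\<epsilon> :: nat \<Rightarrow> int). \<sigma> permutes {1..n} \<and> (\<forall>i\<in>{1..n}. \<epsilon> i \<in> {1, -1}) \<and>
        (\<forall>i\<in>{1..n}. Poly_Mapping.lookup \<nu> i = \<epsilon> i * Poly_Mapping.lookup \<mu> (\<sigma> i)) \<and>
        (\<forall>i. i \<notin> {1..n} \<longrightarrow> Poly_Mapping.lookup \<nu> i = Poly_Mapping.lookup \<mu> i))"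

definition weyl_invariant :: "nat \<Rightarrow> laurent \<Rightarrow> bool" where
  "weyl_invariant n p \<longleftrightarrow>
     (\<forall>\<mu> \<nu>. weyl_conj n \<mu> \<nu> \<longrightarrow> Poly_Mapping.lookup p \<mu> = Poly_Mapping.lookup p \<nu>)"

text \<open>Partitions \<open>\<lambda>\<^sub>1 \<ge> \<dots> \<ge> \<lambda>\<^sub>n \<ge> 0\<close> are the dominant exponent vectors.\<close>

definition is_partition :: "nat \<Rightarrow> exponent \<Rightarrow> bool" where
  "is_partition n l \<longleftrightarrow>
     Poly_Mapping.keys l \<subseteq> {1..n} \<and>
     (\<forall>i\<in>{1..n}. 0 \<le> Poly_Mapping.lookup l i) \<and>
     (\<forall>i j. 1 \<le> i \<longrightarrow> i \<le> j \<longrightarrow> j \<le> n \<longrightarrow>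
        Poly_Mapping.lookup l j \<le> Poly_Mapping.lookup l i)"

text \<open>The partitions strictly below \<open>l\<close> in dominance order; the total sizes are not
  required to agree.\<close>

definition below :: "nat \<Rightarrow> exponent \<Rightarrow> exponent set" where
  "below n l = {m. is_partition n m \<and> m \<noteq> l \<and>
     (\<forall>i\<in>{1..n}. (\<Sum>k=1..i. Poly_Mapping.lookup m k) \<le> (\<Sum>k=1..i. Poly_Mapping.lookup l k))}"

definition orbit_sum :: "nat \<Rightarrow> exponent \<Rightarrow> laurent" where
  "orbit_sum n l = (\<Sum>\<mu> | weyl_conj n l \<mu>. Poly_Mapping.single \<mu> 1)"

definition one_column :: "nat \<Rightarrow> exponent" where
  "one_column r = (\<Sum>i=1..r. Poly_Mapping.single i 1)"


section \<open>Koornwinder polynomials\<close>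

text \<open>The choice of the square root is immaterial: \<open>\<alpha> D\<^sub>x\<close> and
  \<open>\<alpha> d\<^sub>\<lambda>\<close> only involve \<open>\<alpha>\<^sup>2\<close>.\<close>

definition alpha :: "complex \<Rightarrow> complex \<Rightarrow> complex \<Rightarrow> complex \<Rightarrow> complex \<Rightarrow> complex" where
  "alpha a b c d q = csqrt (a * b * c * d / q)"

definition koornwinder_op ::
  "nat \<Rightarrow> complex \<Rightarrow> complex \<Rightarrow> complex \<Rightarrow> complex \<Rightarrow> complex \<Rightarrow> complex \<Rightarrow> laurent \<Rightarrow> laurent fract"
where
  "koornwinder_op n a b c d q t p =
    (\<Sum>i=1..n.
       (1 - cst a * Xvar i) * (1 - cst b * Xvar i) * (1 - cst c * Xvar i) * (1 - cst d * Xvar i) /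
       (cst (alpha a b c d q) * cst t ^ (n - 1) * (1 - Xvar i ^ 2) * (1 - cst q * Xvar i ^ 2)) *
       (\<Prod>j\<in>{1..n} - {i}.
          (1 - cst t * Xvar i * Xvar j) * (1 - cst t * Xvar i / Xvar j) /
          ((1 - Xvar i * Xvar j) * (1 - Xvar i / Xvar j))) *
       emb (scale_var q i p - p)) +
    (\<Sum>i=1..n.
       (1 - cst a / Xvar i) * (1 - cst b / Xvar i) * (1 - cst c / Xvar i) * (1 - cst d / Xvar i) /
       (cst (alpha a b c d q) * cst t ^ (n - 1) * (1 - 1 / Xvar i ^ 2) * (1 - cst q / Xvar i ^ 2)) *
       (\<Prod>j\<in>{1..n} - {i}.
          (1 - cst t * Xvar j / Xvar i) * (1 - cst t / (Xvar i * Xvar j)) /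
          ((1 - Xvar j / Xvar i) * (1 - 1 / (Xvar i * Xvar j)))) *
       emb (scale_var (inverse q) i p - p))"

definition koornwinder_eigenvalue ::
  "nat \<Rightarrow> complex \<Rightarrow> complex \<Rightarrow> complex \<Rightarrow> complex \<Rightarrow> complex \<Rightarrow> complex \<Rightarrow> exponent \<Rightarrow> complex"
where
  "koornwinder_eigenvalue n a b c d q t l =
    (\<Sum>j=1..n.
       alpha a b c d q * t ^ (n - j) * q powi (Poly_Mapping.lookup l j)
     + inverse (alpha a b c d q) * t powi (int j - int n) * q powi (- Poly_Mapping.lookup l j)
     - alpha a b c d q * t ^ (n - j)
     - inverse (alpha a b c d q) * t powi (int j - int n))"

text \<open>Genericity: all parameters are nonzero, and the eigenvalues separate comparable
  partitions, which is what makes the triangular eigenvalue problem for the Koornwinder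
  polynomials uniquely solvable.\<close>

definition generic_params ::
  "nat \<Rightarrow> complex \<Rightarrow> complex \<Rightarrow> complex \<Rightarrow> complex \<Rightarrow> complex \<Rightarrow> complex \<Rightarrow> bool"
where
  "generic_params n a b c d q t \<longleftrightarrow>
     a \<noteq> 0 \<and> b \<noteq> 0 \<and> c \<noteq> 0 \<and> d \<noteq> 0 \<and> t \<noteq> 0 \<and> q \<noteq> 0 \<and> norm q < 1 \<and>
     (\<forall>l m. is_partition n l \<longrightarrow> m \<in> below n l \<longrightarrow>
        koornwinder_eigenvalue n a b c d q t m \<noteq> koornwinder_eigenvalue n a b c d q t l)"

definition is_koornwinder ::
  "nat \<Rightarrow> complex \<Rightarrow> complex \<Rightarrow> complex \<Rightarrow> complex \<Rightarrow> complex \<Rightarrow> complex \<Rightarrow> exponent \<Rightarrow> laurent \<Rightarrow> bool"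
where
  "is_koornwinder n a b c d q t l p \<longleftrightarrow>
     laurent_in n p \<and> weyl_invariant n p \<and>
     (\<exists>u. p = orbit_sum n l + (\<Sum>m\<in>below n l. const_laurent (u m) * orbit_sum n m)) \<and>
     koornwinder_op n a b c d q t p = cst (koornwinder_eigenvalue n a b c d q t l) * emb p"

definition koornwinder ::
  "nat \<Rightarrow> complex \<Rightarrow> complex \<Rightarrow> complex \<Rightarrow> complex \<Rightarrow> complex \<Rightarrow> complex \<Rightarrow> exponent \<Rightarrow> laurent"
where
  "koornwinder n a b c d q t l = (THE p. is_koornwinder n a b c d q t l p)"


section \<open>Rational functions in \<open>a\<close>, \<open>c\<close>, \<open>t\<close>\<close>

text \<open>The field \<open>\<complex>(a, c, t)\<close> as the fraction field of \<open>\<complex>[a][c][t]\<close>: the innermost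
  polynomial variable is \<open>a\<close>, the outermost one is \<open>t\<close>.\<close>

type_synonym poly_act = "complex poly poly poly"
type_synonym ratfun = "poly_act fract"

definition var_a :: ratfun where "var_a = Fract [:[:[:0, 1:]:]:] 1"
definition var_c :: ratfun where "var_c = Fract [:[:0, 1:]:] 1"
definition var_t :: ratfun where "var_t = Fract [:0, 1:] 1"

definition eval_poly :: "poly_act \<Rightarrow> complex \<Rightarrow> complex \<Rightarrow> complex \<Rightarrow> complex" where
  "eval_poly p a c t = poly (poly (poly p [:[:t:]:]) [:c:]) a"

text \<open>A rational function is regular at a point if some representation of it has a
  denominator that does not vanish there; its value is only meaningful in that case.\<close>

definition regular_at :: "ratfun \<Rightarrow> complex \<Rightarrow> complex \<Rightarrow> complex \<Rightarrow> bool" where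
  "regular_at r a c t \<longleftrightarrow> (\<exists>N D. r = Fract N D \<and> eval_poly D a c t \<noteq> 0)"

definition eval_ratfun :: "ratfun \<Rightarrow> complex \<Rightarrow> complex \<Rightarrow> complex \<Rightarrow> complex" where
  "eval_ratfun r a c t =
     (THE v. \<exists>N D. r = Fract N D \<and> eval_poly D a c t \<noteq> 0 \<and>
        v = eval_poly N a c t / eval_poly D a c t)"

definition f_coeff :: "ratfun \<Rightarrow> ratfun" where
  "f_coeff s = (1 - 1 / s) * (1 - var_t ^ 2 / (s * var_a ^ 2 * var_c ^ 2)) *
         (1 + var_t / (s * var_a ^ 2)) * (1 + var_t / (s * var_c ^ 2)) /
         ((1 - var_t / (s ^ 2 * var_a ^ 2 * var_c ^ 2)) *
          (1 - var_t ^ 3 / (s ^ 2 * var_a ^ 2 * var_c ^ 2)))"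


section \<open>The transition matrix\<close>

definition P_vec :: "nat \<Rightarrow> complex \<Rightarrow> complex \<Rightarrow> complex \<Rightarrow> complex \<Rightarrow> nat \<Rightarrow> laurent" where
  "P_vec n a c q t i = (if i \<le> n then koornwinder n a (-a) c (-c) q t (one_column (n - i)) else 0)"

definition m_vec :: "nat \<Rightarrow> nat \<Rightarrow> laurent" where
  "m_vec n j = (if j \<le> n then orbit_sum n (one_column (n - j)) else 0)"

text \<open>The \<open>i\<close>-th row of the matrix-vector product is a sum over all \<open>j\<close>; it is truncated
  to \<open>j \<le> n\<close> because \<open>m_vec n j = 0\<close> otherwise. As an identity between rational functions
  of the parameters, it is required at the generic parameters where the entries
  occurring in it are defined.\<close>

definition stability :: "(nat \<Rightarrow> nat \<Rightarrow> ratfun) \<Rightarrow> bool" where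
  "stability C \<longleftrightarrow>
     (\<forall>n\<ge>1. \<forall>a c q t i. generic_params n a (-a) c (-c) q t \<longrightarrow>
        (\<forall>j\<le>n. regular_at (C i j) a c t) \<longrightarrow>
        P_vec n a c q t i = (\<Sum>j\<le>n. const_laurent (eval_ratfun (C i j) a c t) * m_vec n j))"

definition recursion_relations :: "(nat \<Rightarrow> nat \<Rightarrow> ratfun) \<Rightarrow> bool" where
  "recursion_relations C \<longleftrightarrow>
     C 0 0 = 1 \<and>
     (\<forall>i\<ge>1. C (i - 1) (i - 1) = C i i) \<and>
     (\<forall>j\<ge>2. even j \<longrightarrow> f_coeff var_t * C 1 (j - 1) = C 0 j) \<and>
     (\<forall>i j. even (i + j) \<longrightarrow> 0 < i \<longrightarrow> i < j \<longrightarrow>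
        C (i - 1) (j - 1) + f_coeff (var_t ^ (i + 1)) * C (i + 1) (j - 1) = C i j)"

definition even_upper_triangular :: "(nat \<Rightarrow> nat \<Rightarrow> ratfun) \<Rightarrow> bool" where
  "even_upper_triangular C \<longleftrightarrow>
     (\<forall>i j. j < i \<longrightarrow> C i j = 0) \<and> (\<forall>i j. odd (i + j) \<longrightarrow> C i j = 0)"

end

(* Write y_i = x_i + 1/x_i. The orbit sum of (1^r) is the elementary symmetric polynomial e_r(y), so
   Q(w) = prod_i (w - y_i) is the generating polynomial of the one-column orbit sums. Let p_k(w) be the
   monic polynomials with w p_k = p_(k+1) + f(t^k) p_(k-1); they are Askey-Wilson polynomials in base t
   with parameters a, -a, c, -c and do not involve q or n. The recursion relations say precisely that
   w^k = sum_i C_(i,k) p_i(w), so Q(w) = sum_i (-1)^(n-i) F_i p_i(w) with F_i = sum_j C_(i,j) m_(1^(n-j)).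
   At y = y_i, each summand of the Koornwinder operator applied to Q is, by a product formula, a value of the
   Askey-Wilson operator applied to Q; Lagrange interpolation at the points y_i then gives
   D_x Q = sum_i (-1)^(n-i) d_(1^(n-i)) F_i p_i(w), whence F_i = P_(1^(n-i)) by triangularity. Conversely the
   F_i determine the entries of C at every generic point, and generic points are dense. *)

theory Submission
  imports Defs "HOL-Analysis.Continuum_Not_Denumerable"
begin


section \<open>Orthogonal polynomials, Catalan matrix and elementary symmetric polynomials\<close>

text \<open>The factor 1 - q u^2 in the denominator of the Koornwinder coefficient cancels against
  jouk u - jouk (q u), the amount by which the shift moves y_i, and the product over j \<noteq> i
  becomes a quotient of values of Q / (w - y_i) at jouk (t u) and jouk u. So only t shifts the
  argument, and q survives in the constant (1 - q) / (q \<alpha>) alone. The eigenvalue equation for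
  p_(k+2) follows from those in lower degrees as soon as the three-term coefficients satisfy a
  first-order recurrence, and f(t^k) solves it. The delicate point is evaluation: stability speaks
  of every generic point, but genericity only separates eigenvalues of comparable partitions.
  Applied to columns whose heights differ by two, it gives a^2 c^2 t^(2k-1) \<noteq> 1 for 1 \<le> k
  < n. This keeps f(t^k) finite for all k < n, once the factors 1 - t/(a^2 c^2) of f(t) are
  cancelled. These conditions allow t = 1 and t = a^2 c^2; hence divided differences instead of
  differences, and a reduced form of f(t).\<close>

fun catalan :: "(nat \<Rightarrow> 'a::comm_ring_1) \<Rightarrow> nat \<Rightarrow> nat \<Rightarrow> 'a" where
  "catalan \<phi> i 0 = (if i = 0 then 1 else 0)"
| "catalan \<phi> 0 (Suc j) = \<phi> 1 * catalan \<phi> 1 j"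
| "catalan \<phi> (Suc i) (Suc j) = catalan \<phi> i j + \<phi> (Suc (Suc i)) * catalan \<phi> (Suc (Suc i)) j"

text \<open>\<open>catalan \<phi> i j\<close> sums, over the paths of j steps up or down that start
  at height 0, end at height i and never go below 0, the product of the weights
  \<open>\<phi> h\<close> of the steps down from height h. Such a path reaches at most height j, and
  its height has the parity of the number of steps. The diagonal counts the single path without
  steps down.\<close>

lemma catalan_upper: "j < i \<Longrightarrow> catalan \<phi> i j = 0"
  by (induction \<phi> i j rule: catalan.induct) auto

lemma catalan_odd: "odd (i + j) \<Longrightarrow> catalan \<phi> i j = 0"
  by (induction \<phi> i j rule: catalan.induct) (auto simp: odd_pos)

lemma catalan_diag: "catalan \<phi> i i = 1"
  by (induction i) (auto simp: catalan_upper)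

fun orth_poly :: "(nat \<Rightarrow> 'a::comm_ring_1) \<Rightarrow> nat \<Rightarrow> 'a poly" where
  "orth_poly \<phi> 0 = 1"
| "orth_poly \<phi> (Suc 0) = [:0, 1:]"
| "orth_poly \<phi> (Suc (Suc k)) = pCons 0 (orth_poly \<phi> (Suc k)) - smult (\<phi> (Suc k)) (orth_poly \<phi> k)"

lemma pCons_orth_poly:
  "pCons 0 (orth_poly \<phi> k) =
     orth_poly \<phi> (Suc k) + (case k of 0 \<Rightarrow> 0 | Suc h \<Rightarrow> smult (\<phi> k) (orth_poly \<phi> h))"
  by (cases k) (auto simp: one_pCons)

lemma coeff_orth_poly: "k \<le> j \<Longrightarrow> coeff (orth_poly \<phi> k) j = (if j = k then 1 else 0)"
proof (induction \<phi> k arbitrary: j rule: orth_poly.induct)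
  case (2 \<phi>)
  then show ?case by (auto simp: coeff_pCons split: nat.splits)
next
  case (3 \<phi> k)
  from 3(3) obtain h where "j = Suc h" "Suc k \<le> h" by (cases j) auto
  then show ?case using 3(1)[of h] 3(2)[of j] by auto
qed (auto simp: coeff_1)

lemma orth_poly_independent:
  assumes "(\<Sum>k\<le>n. smult (a k) (orth_poly \<phi> k)) = 0" "k \<le> n"
  shows "a k = 0"
  using assms
proof (induction n)
  case 0
  then have "coeff (smult (a 0) (orth_poly \<phi> 0)) 0 = 0" by simp
  then show ?case using 0 by simp
next
  case (Suc n)
  have "coeff (\<Sum>k\<le>Suc n. smult (a k) (orth_poly \<phi> k)) (Suc n) = a (Suc n)"
    by (simp add: coeff_sum coeff_orth_poly del: orth_poly.simps)
  then have "a (Suc n) = 0" using Suc.prems(1) by (metis coeff_0)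
  then show ?case using Suc by (cases "k = Suc n") auto
qed

text \<open>Multiplication by the variable sends each p_i to p_(i+1) plus \<open>\<phi> i\<close>
  times p_(i-1). On the coefficients this is the recursion of \<open>catalan\<close>: a step up or a
  weighted step down.\<close>

lemma monom_orth_poly:
  "k \<le> n \<Longrightarrow> monom 1 k = (\<Sum>i\<le>n. smult (catalan \<phi> i k) (orth_poly \<phi> i))"
proof (induction k)
  case 0
  then show ?case by (simp add: if_distrib[of "\<lambda>c. smult c _"] sum.delta cong: if_cong)
next
  case (Suc k)
  then obtain m where m: "n = Suc m" "k \<le> m" by (cases n) auto
  have "monom (1::'a) (Suc k) = pCons 0 (monom 1 k)" by (simp add: monom_Suc)
  also have "\<dots> = (\<Sum>i\<le>n. smult (catalan \<phi> i k) (pCons 0 (orth_poly \<phi> i)))"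
    using Suc by (simp add: poly_eq_iff coeff_sum coeff_pCons split: nat.splits)
  also have "\<dots> = (\<Sum>i\<le>n. smult (catalan \<phi> i k) (orth_poly \<phi> (Suc i))) +
      (\<Sum>i\<le>n. smult (catalan \<phi> i k) (case i of 0 \<Rightarrow> 0 | Suc h \<Rightarrow> smult (\<phi> i) (orth_poly \<phi> h)))"
    by (simp only: pCons_orth_poly smult_add_right sum.distrib)
  \<comment> \<open>By triangularity the terms with i > m vanish, as k \<le> m. This allows cutting
    the range here and extending it again below.\<close>
  also have "(\<Sum>i\<le>n. smult (catalan \<phi> i k) (orth_poly \<phi> (Suc i))) =
      (\<Sum>i\<le>m. smult (catalan \<phi> i k) (orth_poly \<phi> (Suc i)))"
    using m by (simp add: catalan_upper)
  also have "(\<Sum>i\<le>n. smult (catalan \<phi> i k) (case i of 0 \<Rightarrow> 0 | Suc h \<Rightarrow> smult (\<phi> i) (orth_poly \<phi> h))) =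
     (\<Sum>i\<le>m. smult (\<phi> (Suc i) * catalan \<phi> (Suc i) k) (orth_poly \<phi> i))"
    unfolding m sum.atMost_Suc_shift by (simp add: mult.commute)
  also have "\<dots> = (\<Sum>i\<le>n. smult (\<phi> (Suc i) * catalan \<phi> (Suc i) k) (orth_poly \<phi> i))"
    using m by (simp add: catalan_upper)
  also have "\<dots> = smult (\<phi> 1 * catalan \<phi> 1 k) (orth_poly \<phi> 0) +
     (\<Sum>i\<le>m. smult (\<phi> (Suc (Suc i)) * catalan \<phi> (Suc (Suc i)) k) (orth_poly \<phi> (Suc i)))"
    unfolding m sum.atMost_Suc_shift by simp
  also have "(\<Sum>i\<le>m. smult (catalan \<phi> i k) (orth_poly \<phi> (Suc i))) + \<dots> =
    (\<Sum>i\<le>n. smult (catalan \<phi> i (Suc k)) (orth_poly \<phi> i))"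
    unfolding m sum.atMost_Suc_shift
    by (simp add: smult_add_left sum.distrib del: orth_poly.simps(2,3))
  finally show ?case .
qed

text \<open>The induction step of \<open>aw_orth_poly\<close>: \<open>h\<close> and \<open>v\<close> stand for divided differences and values of
  the orthogonal polynomials, with suffixes \<open>k\<close>, \<open>m\<close>, \<open>0\<close>, \<open>1\<close>, \<open>2\<close> for the degrees \<open>k - 2, \<dots>, k + 2\<close>.
  The factors \<open>f0\<close>, \<open>fm\<close> make the hypotheses in the low degrees trivial for \<open>k < 2\<close>.\<close>

lemma step_identity:
  fixes X X' g g' w t \<kappa>0 \<kappa>2 P :: "'a::field"
  assumes X: "X^2 = \<tau>*w*X - w^2 - \<sigma>" "X'^2 = \<tau>*w*X' - w^2 - \<sigma>"
    and U1: "g + g' = (1 - P) * w" and UX: "g * X + g' * X' = \<kappa>2 * w^2 + \<kappa>0"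
    and h1: "h1 = X * h0 + v0 - f0 * hm" "h1' = X' * h0' + v0 - f0 * hm'"
    and h0: "f0 * (X * hm + vm) = f0 * (h0 + fm * hk)" "f0 * (X' * hm' + vm) = f0 * (h0' + fm * hk')"
    and v1: "v1 = w * v0 - f0 * vm" and v0: "f0 * (w * vm) = f0 * (v0 + fm * vk)"
    and E1: "g * h1 + g' * h1' = l1 * v1" and E0: "g * h0 + g' * h0' = l0 * v0"
    and Em: "f0 * (g * hm + g' * hm') = f0 * (lm * vm)"
    and Ek: "f0 * fm * (g * hk + g' * hk') = f0 * fm * (lk * vk)"
    and L1: "\<tau>*l1 - \<tau>*(1-P) - l0 + (1-P) + \<kappa>2 = l2"
    and L2: "f0 * fm * (l2 - lk) = f0 * fm * (\<tau> * (l1 - lm))"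
    and L3: "f1 * (l2 - l0) + f0 * (l2 - l0 - \<tau>*l1 + \<tau>*lm) = \<sigma>*l0 - \<kappa>0"
    and h2: "h2 = X * h1 + v1 - f1 * h0" "h2' = X' * h1' + v1 - f1 * h0'"
    and v2: "v2 = w * v1 - f1 * v0"
  shows "g * h2 + g' * h2' = l2 * v2"
proof -
  \<comment> \<open>Induction gives no direct value of the operator on X * h0; it is read off from
    \<open>E1\<close>, since h1 contains X * h0. The quadratic equation of X and X' then handles X^2
    * h0.\<close>
  have UXh: "g * (X * h0) + g' * (X' * h0') = l1 * v1 - (1-P)*w*v0 + f0*lm*vm"
    using h1 E1 U1 Em by algebra
  have UXXh: "g * (X^2 * h0) + g' * (X'^2 * h0') = \<tau>*w*(l1 * v1 - (1-P)*w*v0 + f0*lm*vm) - (w^2+\<sigma>)*l0*v0"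
    using X UXh E0 by algebra
  \<comment> \<open>Unfolding h1 produces X * hm, which is traded for h0 + fm * hk - vm. This is why
    the induction reaches down to the degree of hk.\<close>
  have H: "h2 = X^2*h0 + (X+w)*v0 - (f0+f1)*h0 - f0*fm*hk"
    "h2' = X'^2*h0' + (X'+w)*v0 - (f0+f1)*h0' - f0*fm*hk'"
    using h2 h1 h0 v1 by algebra+
  have UH: "g * h2 + g' * h2' = \<tau>*w*(l1 * v1 - (1-P)*w*v0 + f0*lm*vm) - (w^2+\<sigma>)*l0*v0
    + (\<kappa>2*w^2+\<kappa>0 + (1-P)*w*w) * v0 - (f0+f1)*l0*v0 - f0*fm*lk*vk"
    unfolding H using UXXh U1 UX E0 Ek by algebra
  have V: "v2 = w^2*v0 - (f0+f1)*v0 - f0*fm*vk" using v2 v1 v0 by algebra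
  have W: "w * v1 = w^2 * v0 - f0 * v0 - f0*fm*vk" using v1 v0 by algebra
  have "\<tau>*w*(l1 * v1 - (1-P)*w*v0 + f0*lm*vm) =
     \<tau>*l1*(w^2 * v0 - f0 * v0 - f0*fm*vk) - \<tau>*(1-P)*w^2*v0 + \<tau>*lm*(f0*v0 + f0*fm*vk)"
    using W v0 by algebra
  \<comment> \<open>Both sides are now combinations of w^2 * v0, v0 and f0 * fm * vk; comparing the
    coefficients gives \<open>L1\<close>, \<open>L3\<close> and \<open>L2\<close>
    respectively.\<close>
  then show ?thesis unfolding UH V using L1 L2 L3 by algebra
qed

section \<open>The Askey-Wilson operator and its eigenvalue equation\<close>

definition jouk :: "'a::field \<Rightarrow> 'a" where
  "jouk u = u + 1 / u"

text \<open>Up to the constant (1 - t) / t, this is the Askey-Wilson coefficient (1 - A u^2)(1 - C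
  u^2) / ((1 - u^2)(1 - t u^2)) times the step jouk (t u) - jouk u. The parameters are a, -a, c, -c
  with A = a^2 and C = c^2.\<close>

definition aw_weight :: "'a::field \<Rightarrow> 'a \<Rightarrow> 'a \<Rightarrow> 'a" where
  "aw_weight A C u = (1 - A * u^2) * (1 - C * u^2) / (u * (1 - u^2))"

text \<open>The Askey-Wilson eigenvalue (t^(-k) - 1)(1 - P t^(k-1)), multiplied by t / (1 - t) and
  written as a sum so that it makes sense at t = 1.\<close>

definition aw_eigenvalue :: "'a::field \<Rightarrow> 'a \<Rightarrow> nat \<Rightarrow> 'a" where
  "aw_eigenvalue P t k = (\<Sum>m<k. 1 / t^m - P * t^m)"

text \<open>The two shifted points are the roots of one quadratic polynomial: their sum is (t + 1/t)
  jouk z and their product is (jouk z)^2 + (t - 1/t)^2.\<close>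

lemma jouk_square:
  fixes z t :: "'a::field"
  assumes "z \<noteq> 0" "t \<noteq> 0"
  shows "(jouk (t * z))^2 = (t + 1/t) * jouk z * jouk (t * z) - (jouk z)^2 - (t - 1/t)^2"
    and "(jouk (z / t))^2 = (t + 1/t) * jouk z * jouk (z / t) - (jouk z)^2 - (t - 1/t)^2"
  using assms by (simp_all add: jouk_def field_simps power2_eq_square)

lemma aw_weight_inverse:
  fixes z :: "'a::field"
  assumes "z \<noteq> 0" "z^2 \<noteq> 1"
  shows "aw_weight A C (1 / z) = - ((z^2 - A) * (z^2 - C)) / (z * (1 - z^2))"
proof -
  have "1 - z^2 \<noteq> 0" "z^2 - 1 \<noteq> 0" using assms by auto
  then show ?thesis using assms(1)
    by (simp add: aw_weight_def frac_eq_eq power_divide) (simp add: divide_simps, algebra)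
qed

lemma aw_weight_sum:
  fixes z t :: "'a::field"
  assumes "z \<noteq> 0" "z^2 \<noteq> 1"
  shows "aw_weight A C z + aw_weight A C (1 / z) = (1 - A * C) * jouk z"
proof -
  have "1 - z^2 \<noteq> 0" using assms by auto
  then show ?thesis using assms(1) unfolding aw_weight_inverse[OF assms] aw_weight_def jouk_def
    by (simp add: divide_simps) algebra
qed

text \<open>The divided difference of w^2 between jouk z and X is X + jouk z, so this identity and
  \<open>aw_weight_sum\<close> describe the operator on w^2. Adding the terms for z and 1/z removes
  the pole at z^2 = 1.\<close>

lemma aw_weight_jouk_sum:
  fixes z t :: "'a::field"
  assumes "z \<noteq> 0" "z^2 \<noteq> 1" "t \<noteq> 0"
  shows "aw_weight A C z * jouk (t * z) + aw_weight A C (1 / z) * jouk (z / t) =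
    (1 / t - A * C * t) * (jouk z)^2 + (t - 1/t) * (1 + A) * (1 + C)"
proof -
  have "1 - z^2 \<noteq> 0" using assms by auto
  then show ?thesis using assms(1,3) unfolding aw_weight_inverse[OF assms(1,2)] aw_weight_def jouk_def
    by (simp add: divide_simps) algebra
qed

lemma synthetic_div_diff: "synthetic_div (p - q) c = synthetic_div p c - synthetic_div q c"
  for p q :: "'a::comm_ring_1 poly"
proof -
  have "(p - q) + smult c (synthetic_div p c - synthetic_div q c) =
    pCons (poly (p - q) c) (synthetic_div p c - synthetic_div q c)"
    using synthetic_div_correct[of p c] synthetic_div_correct[of q c]
    by (simp add: smult_diff_right algebra_simps)
  then show ?thesis using synthetic_div_unique by metis
qed

lemma synthetic_div_smult: "synthetic_div (smult a p) c = smult a (synthetic_div p c)"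
  for p :: "'a::comm_ring_1 poly"
  by (induction p) auto

lemma synthetic_div_add: "synthetic_div (p + q) c = synthetic_div p c + synthetic_div q c"
  for p q :: "'a::comm_ring_1 poly"
  by (induction p q rule: poly_induct2) auto

text \<open>The eigenvalue equation of the Askey-Wilson operator, divided by \<open>1 - t\<close>: differences of values
  become divided differences \<open>synthetic_div p y\<close>, so that \<open>t = 1\<close> is not an exception.\<close>

lemma aw_orth_poly:
  fixes \<phi> :: "nat \<Rightarrow> 'a::field" and A C z t :: 'a
  defines "g \<equiv> aw_weight A C" and "l \<equiv> aw_eigenvalue (A * C)"
  assumes z: "z \<noteq> 0" "z^2 \<noteq> 1" and t: "t \<noteq> 0" and "\<phi> 0 = 0"
    and rec: "\<And>k. k + 2 \<le> n \<Longrightarrow> \<phi> (k + 1) * (l t (k + 2) - l t k) =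
      \<phi> k * ((1 + 1/t) * (t^3 - A*C*(t^k)^2) / (t * t^k)) +
      (t - 1/t)^2 * l t k - (t - 1/t) * (1 + A) * (1 + C)"
    and "k \<le> n"
  shows "g z * poly (synthetic_div (orth_poly \<phi> k) (jouk z)) (jouk (t * z)) +
     g (1 / z) * poly (synthetic_div (orth_poly \<phi> k) (jouk z)) (jouk (z / t)) =
     l t k * poly (orth_poly \<phi> k) (jouk z)"
  using \<open>k \<le> n\<close>
proof (induction k rule: less_induct)
  case (less k)
  define v where "v k = poly (orth_poly \<phi> k) (jouk z)" for k
  define h where "h x k = poly (synthetic_div (orth_poly \<phi> k) (jouk z)) x" for x k
  have R: "h x (Suc k) = x * h x k + v k - \<phi> k * h x (k - 1)" for x k
    by (cases k) (auto simp: h_def v_def one_pCons synthetic_div_diff synthetic_div_smult \<open>\<phi> 0 = 0\<close>)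
  have S: "v (Suc k) = jouk z * v k - \<phi> k * v (k - 1)" for k
    by (cases k) (auto simp: v_def \<open>\<phi> 0 = 0\<close>)
  have IH: "g z * h (jouk (t*z)) j + g (1/z) * h (jouk (z/t)) j = l t j * v j" if "j < k" for j
    using less.IH[OF that] less.prems that by (simp add: h_def v_def)
  have l_Suc: "l t (Suc j) = l t j + 1 / t^j - A*C*t^j" for j
    by (simp add: l_def aw_eigenvalue_def)
  have l_1: "l t (Suc 0) = 1 - A*C" "l t 0 = 0" by (simp_all add: l_def aw_eigenvalue_def)
  consider "k = 0" | "k = 1" | m where "k = Suc (Suc m)" by (metis One_nat_def nat.exhaust)
  then have "g z * h (jouk (t*z)) k + g (1/z) * h (jouk (z/t)) k = l t k * v k"
  proof cases
    case 1
    then show ?thesis by (simp add: h_def l_def aw_eigenvalue_def one_pCons)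
  next
    case 2
    then show ?thesis using aw_weight_sum[OF z, of A C]
      by (simp add: h_def v_def l_def aw_eigenvalue_def g_def)
  next
    case 3
    let ?X = "jouk (t*z)" and ?X' = "jouk (z/t)" and ?w = "jouk z"
    have r: "\<phi> (m+1) * (l t (m+2) - l t m) =
      \<phi> m * ((1 + 1/t) * (t^3 - A*C*(t^m)^2) / (t * t^m)) +
      (t - 1/t)^2 * l t m - (t - 1/t) * (1 + A) * (1 + C)"
      using rec[of m] less.prems 3 by simp
    show ?thesis unfolding 3
    proof (rule step_identity[where ?f0.0 = "\<phi> m" and fm = "\<phi> (m-1)" and hm = "h ?X (m-1)"
         and hm' = "h ?X' (m-1)" and vm = "v (m-1)" and hk = "h ?X (m-2)" and hk' = "h ?X' (m-2)"
         and vk = "v (m-2)" and ?v0.0 = "v m" and ?v1.0 = "v (Suc m)" and w = ?w and X = ?X and X' = ?X'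
         and P = "A*C" and \<tau> = "t + 1/t" and \<sigma> = "(t - 1/t)^2" and ?\<kappa>2.0 = "1/t - A*C*t"
         and ?\<kappa>0.0 = "(t - 1/t) * (1 + A) * (1 + C)" and ?l0.0 = "l t m" and ?l1.0 = "l t (Suc m)"
         and lm = "l t (m-1)" and lk = "l t (m-2)" and ?f1.0 = "\<phi> (Suc m)"
         and ?h0.0 = "h ?X m" and h0' = "h ?X' m" and ?h1.0 = "h ?X (Suc m)" and h1' = "h ?X' (Suc m)"])
      show "(t + 1/t) * l t (Suc m) - (t + 1/t) * (1 - A*C) - l t m + (1 - A*C) + (1/t - A*C*t) =
        l t (Suc (Suc m))"
      proof (induction m)
        case 0
        then show ?case using t by (simp add: l_Suc l_1 field_simps)
      next
        case (Suc m)
        define d where "d j = 1 / t^j - A*C*t^j" for j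
        have l_d: "l t (Suc j) = l t j + d j" for j by (simp add: l_Suc d_def)
        \<comment> \<open>The increments are combinations of t^j and t^(-j), so they obey the linear
          recurrence with characteristic roots t and 1/t.\<close>
        have d: "(t + 1/t) * d (Suc m) - d m = d (Suc (Suc m))"
          using t by (simp add: d_def field_simps)
        have "(t + 1/t) * (l t (Suc m) + d (Suc m)) - (t + 1/t) * (1 - A*C) - l t (Suc m) + (1 - A*C)
            + (1/t - A*C*t) =
          ((t + 1/t) * l t (Suc m) - (t + 1/t) * (1 - A*C) - l t m + (1 - A*C) + (1/t - A*C*t))
            + ((t + 1/t) * d (Suc m) - d m)"
          unfolding l_d[of m] by (simp add: algebra_simps)
        then show ?case unfolding Suc d by (simp only: l_d)
      qed
      show "\<phi> m * \<phi> (m-1) * (l t (Suc (Suc m)) - l t (m-2)) =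
        \<phi> m * \<phi> (m-1) * ((t + 1/t) * (l t (Suc m) - l t (m-1)))"
      proof (cases "m \<le> 1")
        case True
        then show ?thesis using \<open>\<phi> 0 = 0\<close> by (cases m) auto
      next
        case False
        then obtain j where j: "m = Suc (Suc j)" by (metis One_nat_def less_eq_nat.simps(1) nat.exhaust not_less_eq_eq)
        have "l t (Suc (Suc (Suc (Suc j)))) - l t j = (t + 1/t) * (l t (Suc (Suc (Suc j))) - l t (Suc j))"
          using t by (simp add: l_Suc field_simps)
        then show ?thesis unfolding j by simp
      qed
      \<comment> \<open>This is the assumed recurrence \<open>rec\<close> rearranged: the
        combination of eigenvalues multiplying \<open>\<phi> m\<close> on the left collapses to
        minus the explicit factor of \<open>\<phi> m\<close> in \<open>rec\<close>.\<close>
      show "\<phi> (Suc m) * (l t (Suc (Suc m)) - l t m) +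
        \<phi> m * (l t (Suc (Suc m)) - l t m - (t + 1/t) * l t (Suc m) + (t + 1/t) * l t (m-1)) =
        (t - 1/t)^2 * l t m - (t - 1/t) * (1 + A) * (1 + C)"
      proof (cases m)
        case 0
        then show ?thesis using r \<open>\<phi> 0 = 0\<close> by simp
      next
        case (Suc j)
        define p where "p = t^j"
        have p: "p \<noteq> 0" "t^m = t * p" "t^Suc m = t * (t * p)" "t^j = p" using t by (simp_all add: p_def Suc)
        have l2: "l t (Suc (Suc m)) = l t m + (1 / (t*p) - A*C*(t*p)) + (1 / (t*(t*p)) - A*C*(t*(t*p)))"
          "l t (Suc m) = l t (m-1) + (1 / p - A*C*p) + (1 / (t*p) - A*C*(t*p))"
          using l_Suc[of "Suc m"] l_Suc[of m] l_Suc[of j] p(2-4) by (simp_all add: Suc)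
        have "(1 / (t*p) - A*C*(t*p)) + (1 / (t*(t*p)) - A*C*(t*(t*p))) -
            (t + 1/t) * ((1 / p - A*C*p) + (1 / (t*p) - A*C*(t*p))) =
          - ((1 + 1/t) * (t^3 - A*C*(t*p)^2) / (t * (t*p)))"
          using t p(1) by (simp add: divide_simps) algebra
        moreover have "x2 - l0 - T * x1 + T * y0 = E"
          if "a + b - T * (c + a) = E" "x2 = l0 + a + b" "x1 = y0 + c + a" for a b c T E x1 x2 l0 y0 :: 'a
          unfolding that(1)[symmetric] that(2,3) by (simp add: algebra_simps)
        ultimately have e: "l t (Suc (Suc m)) - l t m - (t + 1/t) * l t (Suc m) + (t + 1/t) * l t (m-1) =
          - ((1 + 1/t) * (t^3 - A*C*(t*p)^2) / (t * (t*p)))"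
          using l2 by blast
        have r': "\<phi> (Suc m) * (l t (Suc (Suc m)) - l t m) =
          \<phi> m * ((1 + 1/t) * (t^3 - A*C*(t*p)^2) / (t * (t*p))) +
          (t - 1/t)^2 * l t m - (t - 1/t) * (1 + A) * (1 + C)"
          using r unfolding p(2) by simp
        show ?thesis unfolding e r' by (simp only: mult_minus_right) (simp only: algebra_simps add_0_left add_0_right right_minus)
      qed
      show "\<phi> m * (?X * h ?X (m-1) + v (m-1)) = \<phi> m * (h ?X m + \<phi> (m-1) * h ?X (m-2))"
        "\<phi> m * (?X' * h ?X' (m-1) + v (m-1)) = \<phi> m * (h ?X' m + \<phi> (m-1) * h ?X' (m-2))"
        "\<phi> m * (?w * v (m-1)) = \<phi> m * (v m + \<phi> (m-1) * v (m-2))"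
        using \<open>\<phi> 0 = 0\<close> by (cases m; simp add: R S numeral_2_eq_2)+
      show "\<phi> m * (g z * h ?X (m-1) + g (1/z) * h ?X' (m-1)) = \<phi> m * (l t (m-1) * v (m-1))"
       "\<phi> m * \<phi> (m-1) * (g z * h ?X (m-2) + g (1/z) * h ?X' (m-2)) = \<phi> m * \<phi> (m-1) * (l t (m-2) * v (m-2))"
        using IH[of "m-1"] IH[of "m-2"] 3 by simp_all
      show "h ?X (Suc m) = ?X * h ?X m + v m - \<phi> m * h ?X (m-1)"
        "h ?X' (Suc m) = ?X' * h ?X' m + v m - \<phi> m * h ?X' (m-1)"
        "v (Suc m) = ?w * v m - \<phi> m * v (m-1)"
        by (rule R S)+
      show "h ?X (Suc (Suc m)) = ?X * h ?X (Suc m) + v (Suc m) - \<phi> (Suc m) * h ?X m"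
        "h ?X' (Suc (Suc m)) = ?X' * h ?X' (Suc m) + v (Suc m) - \<phi> (Suc m) * h ?X' m"
        "v (Suc (Suc m)) = ?w * v (Suc m) - \<phi> (Suc m) * v m"
        using R[of _ "Suc m"] S[of "Suc m"] by (simp_all only: diff_Suc_1)
      show "g z * h ?X m + g (1/z) * h ?X' m = l t m * v m"
        "g z * h ?X (Suc m) + g (1/z) * h ?X' (Suc m) = l t (Suc m) * v (Suc m)"
        using IH[of m] IH[of "Suc m"] 3 by simp_all
      show "?X^2 = (t + 1/t) * ?w * ?X - ?w^2 - (t - 1/t)^2"
        "?X'^2 = (t + 1/t) * ?w * ?X' - ?w^2 - (t - 1/t)^2"
        using jouk_square[OF z(1) t] .
      show "g z + g (1/z) = (1 - A*C) * ?w"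
        unfolding g_def by (rule aw_weight_sum[OF z])
      show "g z * ?X + g (1/z) * ?X' = (1/t - A*C*t) * ?w^2 + (t - 1/t) * (1 + A) * (1 + C)"
        unfolding g_def by (rule aw_weight_jouk_sum[OF z t])
    qed
  qed
  then show ?case by (simp add: h_def v_def)
qed


section \<open>Lagrange interpolation and the generating polynomial of the columns\<close>

lemma lagrange_interpolation:
  fixes S :: "'a::field poly" and y :: "'b \<Rightarrow> 'a"
  assumes "finite I" "inj_on y I" and S: "\<And>j. card I \<le> j \<Longrightarrow> coeff S j = 0"
  shows "S = (\<Sum>i\<in>I. smult (poly S (y i) / (\<Prod>j\<in>I - {i}. y i - y j)) (\<Prod>j\<in>I - {i}. [:- y j, 1:]))"
    (is "S = ?R")
proof (rule ccontr)
  assume "S \<noteq> ?R"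
  then have nz: "S - ?R \<noteq> 0" by simp
  have "poly ?R (y k) = poly S (y k)" if k: "k \<in> I" for k
  proof -
    have "poly (\<Prod>j\<in>I - {i}. [:- y j, 1:]) (y k) = 0" if "i \<in> I - {k}" for i
      unfolding poly_prod by (rule prod_zero) (use that k assms(1) in auto)
    then have "poly ?R (y k) = poly S (y k) / (\<Prod>j\<in>I - {k}. y k - y j) * (\<Prod>j\<in>I - {k}. y k - y j)"
      using k assms(1) by (simp add: poly_sum sum.remove[of I k] poly_prod[of _ "I - {k}"])
    moreover have "(\<Prod>j\<in>I - {k}. y k - y j) \<noteq> 0"
      using assms(1,2) k by (auto simp: inj_on_def)
    ultimately show ?thesis by simp
  qed
  then have "y ` I \<subseteq> {x. poly (S - ?R) x = 0}" by auto
  then have "card (y ` I) \<le> card {x. poly (S - ?R) x = 0}"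
    by (intro card_mono poly_roots_finite[OF nz])
  then have "card I \<le> card {x. poly (S - ?R) x = 0}"
    by (simp only: card_image[OF assms(2)])
  also have "\<dots> \<le> degree (S - ?R)" using card_poly_roots_bound[OF nz] .
  finally have le: "card I \<le> degree (S - ?R)" .
  \<comment> \<open>The bound is kept as vanishing of all coefficients from card I on, which also
    covers empty I: there it says that S = 0, while no degree is below 0.\<close>
  have "coeff ?R j = 0" if "card I \<le> j" for j
  proof -
    have "coeff (\<Prod>j\<in>I - {i}. [:- y j, 1:]) j = 0" if i: "i \<in> I" for i
    proof -
      have "degree (\<Prod>j\<in>I - {i}. [:- y j, 1:]) \<le> (\<Sum>j\<in>I - {i}. degree [:- y j, 1:])"
        using degree_prod_sum_le[of "I - {i}" "\<lambda>j. [:- y j, 1:]"] assms(1) by (simp add: o_def)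
      also have "\<dots> < card I" using i assms(1) card_gt_0_iff[of I] by auto
      finally show ?thesis using \<open>card I \<le> j\<close> by (simp add: coeff_eq_0)
    qed
    then show ?thesis by (simp add: coeff_sum)
  qed
  then have "coeff (S - ?R) (degree (S - ?R)) = 0" using S le by simp
  then show False using nz leading_coeff_0_iff by blast
qed

text \<open>\<open>esym y n r\<close> is the elementary symmetric polynomial \<open>e\<^sub>r(y\<^sub>1, \<dots>, y\<^sub>n)\<close>.\<close>

fun esym :: "(nat \<Rightarrow> 'a::comm_ring_1) \<Rightarrow> nat \<Rightarrow> nat \<Rightarrow> 'a" where
  "esym y 0 r = (if r = 0 then 1 else 0)"
| "esym y (Suc n) 0 = esym y n 0"
| "esym y (Suc n) (Suc r) = esym y n (Suc r) + y (Suc n) * esym y n r"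

lemma esym_eq_0: "n < r \<Longrightarrow> esym y n r = 0"
  by (induction y n r rule: esym.induct) auto

lemma esym_hom:
  assumes "h 1 = 1" "h 0 = 0" "\<And>a b. h (a + b) = h a + h b" "\<And>a b. h (a * b) = h a * h b"
  shows "h (esym y n r) = esym (\<lambda>i. h (y i)) n r"
  by (induction y n r rule: esym.induct) (auto simp: assms)

lemma prod_eq_sum_esym:
  fixes w :: "'a::comm_ring_1"
  shows "(\<Prod>j=1..n. w - y j) = (\<Sum>r\<le>n. (-1)^r * esym y n r * w^(n - r))"
proof (induction n)
  case (Suc n)
  have "(\<Sum>r\<le>Suc n. (-1)^r * esym y (Suc n) r * w^(Suc n - r)) =
    esym y n 0 * w^Suc n + (\<Sum>r\<le>n. (-1)^Suc r * esym y n (Suc r) * w^(n - r)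
      + (- y (Suc n)) * ((-1)^r * esym y n r * w^(n - r)))"
    unfolding sum.atMost_Suc_shift by (intro arg_cong2[where f="(+)"] sum.cong refl)
      (simp_all add: ring_distribs mult.left_commute)
  also have "\<dots> = (esym y n 0 * w^Suc n + (\<Sum>r\<le>n. (-1)^Suc r * esym y n (Suc r) * w^(n - r)))
      + (- y (Suc n)) * (\<Sum>r\<le>n. (-1)^r * esym y n r * w^(n - r))"
    unfolding sum.distrib sum_distrib_left by (simp only: add.assoc)
  also have "esym y n 0 * w^Suc n + (\<Sum>r\<le>n. (-1)^Suc r * esym y n (Suc r) * w^(n - r)) =
    (\<Sum>r\<le>Suc n. (-1)^r * esym y n r * w^(Suc n - r))"
    unfolding sum.atMost_Suc_shift by simp
  also have "\<dots> = (\<Sum>r\<le>n. (-1)^r * esym y n r * w^(Suc n - r))"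
    by (simp add: esym_eq_0)
  also have "\<dots> = w * (\<Sum>r\<le>n. (-1)^r * esym y n r * w^(n - r))"
    unfolding sum_distrib_left
    by (intro sum.cong refl) (simp add: Suc_diff_le mult.left_commute)
  finally have "(\<Sum>r\<le>Suc n. (-1)^r * esym y (Suc n) r * w^(Suc n - r)) =
    (w - y (Suc n)) * (\<Sum>r\<le>n. (-1)^r * esym y n r * w^(n - r))"
    by (simp only: distrib_right diff_conv_add_uminus)
  then show ?case using Suc by (simp add: mult.commute)
qed simp

lemma esym_generating_poly:
  fixes y :: "nat \<Rightarrow> 'a::comm_ring_1"
  shows "(\<Prod>j=1..n. [:- y j, 1:]) = (\<Sum>k\<le>n. smult ((-1)^(n - k) * esym y n (n - k)) (monom 1 k))"
proof -
  \<comment> \<open>Vieta's formula is used inside the polynomial ring: the y_i become constant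
    polynomials and w becomes the indeterminate.\<close>
  have "esym (\<lambda>i. [:y i:]) n r = [:esym y n r:]" for r
    by (rule esym_hom[symmetric]) (auto simp: one_pCons)
  then have "(\<Prod>j=1..n. [:- y j, 1:]) =
      (\<Sum>r\<le>n. (-1)^r * [:esym y n r:] * [:0, 1:]^(n - r))"
    using prod_eq_sum_esym[of "[:0,1:]" "\<lambda>i. [:y i:]" n] by simp
  also have "\<dots> = (\<Sum>r\<le>n. smult ((-1)^r * esym y n r) (monom 1 (n - r)))"
  proof (rule sum.cong)
    fix r
    have "(-1)^r = [:(-1)^r :: 'a:]" by (induction r) (auto simp: one_pCons)
    then show "(-1)^r * [:esym y n r:] * [:0, 1:]^(n - r) = smult ((-1)^r * esym y n r) (monom 1 (n - r))"
      by (simp add: monom_altdef mult.commute)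
  qed simp
  also have "\<dots> = (\<Sum>k\<le>n. smult ((-1)^(n - k) * esym y n (n - k)) (monom 1 k))"
    by (rule sum.reindex_bij_witness[of _ "\<lambda>k. n - k" "\<lambda>k. n - k"]) auto
  finally show ?thesis .
qed

lemma smult_sum_right: "smult c (\<Sum>i\<in>I. f i) = (\<Sum>i\<in>I. smult c (f i))"
  by (induction I rule: infinite_finite_induct) (auto simp: smult_add_right)

lemma esym_orth_expansion:
  fixes y :: "nat \<Rightarrow> 'a::comm_ring_1"
  shows "(\<Prod>j=1..n. [:- y j, 1:]) =
    (\<Sum>i\<le>n. smult ((-1)^(n - i) * (\<Sum>j\<le>n. catalan \<phi> i j * esym y n (n - j))) (orth_poly \<phi> i))"
proof -
  have "(\<Prod>j=1..n. [:- y j, 1:]) = (\<Sum>k\<le>n. \<Sum>i\<le>n.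
     smult ((-1)^(n - k) * esym y n (n - k) * catalan \<phi> i k) (orth_poly \<phi> i))"
    unfolding esym_generating_poly
  proof (intro sum.cong refl)
    fix k assume "k \<in> {..n}"
    then have "monom 1 k = (\<Sum>i\<le>n. smult (catalan \<phi> i k) (orth_poly \<phi> i))"
      by (intro monom_orth_poly) simp
    then show "smult ((-1)^(n - k) * esym y n (n - k)) (monom 1 k) =
        (\<Sum>i\<le>n. smult ((-1)^(n - k) * esym y n (n - k) * catalan \<phi> i k) (orth_poly \<phi> i))"
      by (simp only: smult_sum_right smult_smult)
  qed
  also have "\<dots> = (\<Sum>k\<le>n. \<Sum>i\<le>n.
     smult ((-1)^(n - i) * (catalan \<phi> i k * esym y n (n - k))) (orth_poly \<phi> i))"
  proof (intro sum.cong refl)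
    fix i k assume "i \<in> {..n}" "k \<in> {..n}"
    \<comment> \<open>Evenness enters here: a nonzero entry has i and k of equal parity, so the sign
      can be moved from the column index to the row index and out of the inner sum.\<close>
    then have "(-1)^(n - k) * catalan \<phi> i k = (-1)^(n - i) * catalan \<phi> i k"
      using catalan_odd[of i k \<phi>] by (cases "even (i + k)") (auto simp: minus_one_power_iff)
    then have "(-1)^(n - k) * esym y n (n - k) * catalan \<phi> i k =
        (-1)^(n - i) * catalan \<phi> i k * esym y n (n - k)"
      by (simp only: mult.assoc mult.commute[of "esym y n (n - k)"]) (simp only: mult.assoc[symmetric])
    then show "smult ((-1)^(n - k) * esym y n (n - k) * catalan \<phi> i k) (orth_poly \<phi> i) =
      smult ((-1)^(n - i) * (catalan \<phi> i k * esym y n (n - k))) (orth_poly \<phi> i)" by (simp only: mult.assoc)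
  qed
  also have "\<dots> = (\<Sum>i\<le>n. smult ((-1)^(n - i) * (\<Sum>j\<le>n. catalan \<phi> i j * esym y n (n - j))) (orth_poly \<phi> i))"
    by (subst sum.swap) (simp only: smult_sum sum_distrib_left)
  finally show ?thesis .
qed


section \<open>The kernel identity\<close>

text \<open>This is F_k of the overview, for arbitrary ring elements y, so that the effect of
  shifting one variable is again an instance, with y updated at one index.\<close>

definition column_poly :: "(nat \<Rightarrow> 'a::comm_ring_1) \<Rightarrow> (nat \<Rightarrow> 'a) \<Rightarrow> nat \<Rightarrow> nat \<Rightarrow> 'a" where
  "column_poly \<phi> y n k = (\<Sum>j\<le>n. catalan \<phi> k j * esym y n (n - j))"

text \<open>With u separated from x_i, the choices u = x_i and u = 1/x_i give the coefficients of
  the forward and of the backward shift.\<close>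

definition kw_coeff ::
  "'a::field \<Rightarrow> 'a \<Rightarrow> 'a \<Rightarrow> 'a \<Rightarrow> 'a \<Rightarrow> 'a \<Rightarrow> 'a \<Rightarrow> nat \<Rightarrow> (nat \<Rightarrow> 'a) \<Rightarrow> nat \<Rightarrow> 'a \<Rightarrow> 'a" where
  "kw_coeff a b c d q t \<alpha> n x i u =
     (1 - a * u) * (1 - b * u) * (1 - c * u) * (1 - d * u) / (\<alpha> * t^(n - 1) * (1 - u^2) * (1 - q * u^2)) *
     (\<Prod>j\<in>{1..n} - {i}. (1 - t * u * x j) * (1 - t * u / x j) / ((1 - u * x j) * (1 - u / x j)))"

lemma jouk_factor:
  fixes u v x :: "'a::field"
  assumes "v \<noteq> 0" "x \<noteq> 0"
  shows "(1 - v * x) * (1 - v / x) = v * (jouk v - jouk x)"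
  using assms by (simp add: jouk_def field_simps)

lemma jouk_inverse: "jouk (1 / u) = jouk u"
  by (simp add: jouk_def)

text \<open>By \<open>jouk_factor\<close>, the factors for each j reduce to t times a quotient of
  differences of \<open>jouk\<close> values, and these n - 1 powers of t cancel the normalization
  t^(n-1). The step jouk u - jouk (q u) is a multiple of 1 - q u^2 and cancels that denominator;
  what remains is \<open>aw_weight\<close>, in base t.\<close>

lemma kw_coeff_times_shift:
  fixes u q t \<alpha> :: "'a::field"
  assumes nz: "u \<noteq> 0" "q \<noteq> 0" "t \<noteq> 0" "\<alpha> \<noteq> 0" "u^2 \<noteq> 1" "q * u^2 \<noteq> 1" and x: "\<And>j. x j \<noteq> 0"
    and i: "i \<in> {1..n}"
  shows "kw_coeff a (-a) c (-c) q t \<alpha> n x i u * (jouk u - jouk (q * u)) =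
    - ((1 - q) / (q * \<alpha>)) * (aw_weight (a^2) (c^2) u * (\<Prod>j\<in>{1..n} - {i}. jouk (t * u) - jouk (x j)))
      / (\<Prod>j\<in>{1..n} - {i}. jouk u - jouk (x j))"
proof -
  define N where "N = (\<Prod>j\<in>{1..n} - {i}. jouk (t * u) - jouk (x j))"
  define D where "D = (\<Prod>j\<in>{1..n} - {i}. jouk u - jouk (x j))"
  have "(\<Prod>j\<in>{1..n} - {i}. (1 - t * u * x j) * (1 - t * u / x j) / ((1 - u * x j) * (1 - u / x j)))
      = (\<Prod>j\<in>{1..n} - {i}. t * ((jouk (t * u) - jouk (x j)) / (jouk u - jouk (x j))))"
    by (intro prod.cong refl) (use nz x in \<open>simp add: jouk_factor\<close>)
  also have "\<dots> = t^(n - 1) * (N / D)"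
    using i by (simp add: prod.distrib prod_dividef N_def D_def)
  finally have 1: "kw_coeff a (-a) c (-c) q t \<alpha> n x i u =
     (1 - a * u) * (1 + a * u) * (1 - c * u) * (1 + c * u) / (\<alpha> * t^(n - 1) * (1 - u^2) * (1 - q * u^2)) *
     (t^(n - 1) * (N / D))" by (simp add: kw_coeff_def)
  have nz': "1 - u^2 \<noteq> 0" "1 - q * u^2 \<noteq> 0" using nz by auto
  have 2: "jouk u - jouk (q * u) = - ((1 - q) * (1 - q * u^2) / (q * u))"
    using nz by (simp add: jouk_def field_simps power2_eq_square)
  have 3: "(1 - a * u) * (1 + a * u) * (1 - c * u) * (1 + c * u) = (1 - a^2 * u^2) * (1 - c^2 * u^2)"
    by algebra
  have "X / (\<alpha> * T * w1 * w2) * (T * M) * - ((1 - q) * w2 / (q * u)) =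
      - ((1 - q) / (q * \<alpha>)) * (X / (u * w1) * M)" if "T \<noteq> 0" "w1 \<noteq> 0" "w2 \<noteq> 0" for X T w1 w2 M
    using that nz by (simp add: divide_simps)
  from this[of "t^(n - 1)" "1 - u^2" "1 - q * u^2" _ "N / D"] show ?thesis
    unfolding 1 2 3 aw_weight_def N_def[symmetric] D_def[symmetric]
    using nz(3) nz' by (simp add: ac_simps)
qed

lemma synthetic_div_sum:
  "synthetic_div (\<Sum>i\<in>I. f i) c = (\<Sum>i\<in>I. synthetic_div (f i) c)" for f :: "_ \<Rightarrow> 'a::comm_ring_1 poly"
  by (induction I rule: infinite_finite_induct) (auto simp: synthetic_div_add)

lemma synthetic_div_linear_mult: "synthetic_div ([:- c, 1:] * p) c = p" for p :: "'a::comm_ring_1 poly"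
proof -
  have "[:- c, 1:] * p + smult c p = pCons 0 p" by simp
  then show ?thesis using synthetic_div_unique by metis
qed

text \<open>The equations for all k are obtained together. The operator is applied to the
  coefficients of Q in the basis p_k, and only at the end are the coefficients of the resulting
  polynomial in w compared.\<close>

lemma column_poly_eigen:
  fixes a c q t \<alpha> :: "'a::field" and x :: "nat \<Rightarrow> 'a"
  defines "y \<equiv> \<lambda>i. jouk (x i)" and "l \<equiv> aw_eigenvalue (a^2 * c^2)"
  assumes nz: "q \<noteq> 0" "t \<noteq> 0" "\<alpha> \<noteq> 0" and x: "\<And>j. x j \<noteq> 0" "\<And>j. (x j)^2 \<noteq> 1"
    "\<And>j. q * (x j)^2 \<noteq> 1" "\<And>j. (x j)^2 \<noteq> q" and inj: "inj_on y {1..n}"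
    and \<phi>: "\<phi> 0 = 0"
    and rec: "\<And>k. k + 2 \<le> n \<Longrightarrow> \<phi> (k + 1) * (l t (k + 2) - l t k) =
      \<phi> k * ((1 + 1/t) * (t^3 - a^2*c^2*(t^k)^2) / (t * t^k)) +
      (t - 1/t)^2 * l t k - (t - 1/t) * (1 + a^2) * (1 + c^2)"
    and "k \<le> n"
  shows "(\<Sum>i=1..n. kw_coeff a (-a) c (-c) q t \<alpha> n x i (x i) *
            (column_poly \<phi> (y(i := jouk (q * x i))) n k - column_poly \<phi> y n k)) +
         (\<Sum>i=1..n. kw_coeff a (-a) c (-c) q t \<alpha> n x i (1 / x i) *
            (column_poly \<phi> (y(i := jouk (x i / q))) n k - column_poly \<phi> y n k)) =
     (1 - q) / (q * \<alpha>) * (l t n - l t k) * column_poly \<phi> y n k" (is "?D k = _")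
proof -
  define s where "s k = (-1::'a)^(n - k)" for k
  define e where "e = column_poly \<phi> y n"
  define p where "p = orth_poly \<phi>"
  define \<kappa> where "\<kappa> = (1 - q) / (q * \<alpha>)"
  define Qi where "Qi i = (\<Prod>j\<in>{1..n} - {i}. [:- y j, 1:])" for i
  define Q where "Q = (\<Prod>j=1..n. [:- y j, 1:])"
  define R where "R = (\<Sum>k\<le>n. smult (s k * e k * l t k) (p k))"
  have expand: "(\<Prod>j=1..n. [:- y' j, 1:]) = (\<Sum>k\<le>n. smult (s k * column_poly \<phi> y' n k) (p k))" for y'
    using esym_orth_expansion[of y' n \<phi>] by (simp add: column_poly_def s_def p_def)
  have Q: "Q = (\<Sum>k\<le>n. smult (s k * e k) (p k))" using expand[of y] by (simp add: Q_def e_def)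
  have Q_split: "Q = [:- y i, 1:] * Qi i" if "i \<in> {1..n}" for i
    using that by (simp add: Q_def Qi_def prod.remove)
  \<comment> \<open>Q is affine in each y_i: replacing y_i by z changes it by (y_i - z) Q / (w -
    y_i).\<close>
  have shift: "(\<Sum>k\<le>n. smult (s k * (column_poly \<phi> (y(i := z)) n k - e k)) (p k)) = smult (y i - z) (Qi i)"
    if i: "i \<in> {1..n}" for i z
  proof -
    have "(\<Prod>j=1..n. [:- (y(i := z)) j, 1:]) =
        [:- (y(i := z)) i, 1:] * (\<Prod>j\<in>{1..n} - {i}. [:- (y(i := z)) j, 1:])"
      using i by (intro prod.remove) auto
    also have "\<dots> = [:- z, 1:] * Qi i"
      unfolding Qi_def by (intro arg_cong2[where f = "(*)"] prod.cong) auto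
    finally have pr: "(\<Prod>j=1..n. [:- (y(i := z)) j, 1:]) = [:- z, 1:] * Qi i" .
    have "(\<Sum>k\<le>n. smult (s k * (column_poly \<phi> (y(i := z)) n k - e k)) (p k)) =
        (\<Prod>j=1..n. [:- (y(i := z)) j, 1:]) - Q"
      unfolding expand Q by (simp only: right_diff_distrib smult_diff_left sum_subtractf)
    also have "\<dots> = [:- z, 1:] * Qi i - Q" unfolding pr ..
    also have "\<dots> = smult (y i - z) (Qi i)" unfolding Q_split[OF i]
      by (simp add: smult_diff_left)
    finally show ?thesis .
  qed
  \<comment> \<open>Since Q vanishes at y_i, \<open>Qi i\<close> is its divided difference there. So
    the left side is the Askey-Wilson operator applied to Q, at the point y_i; it acts diagonally on
    the p_k, which gives R.\<close>
  have numer: "aw_weight (a^2) (c^2) (x i) * poly (Qi i) (jouk (t * x i)) +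
      aw_weight (a^2) (c^2) (1 / x i) * poly (Qi i) (jouk (x i / t)) = poly R (y i)" if i: "i \<in> {1..n}" for i
  proof -
    have "Qi i = synthetic_div Q (y i)" unfolding Q_split[OF i] synthetic_div_linear_mult ..
    also have "\<dots> = (\<Sum>k\<le>n. smult (s k * e k) (synthetic_div (p k) (y i)))"
      unfolding Q synthetic_div_sum synthetic_div_smult ..
    finally have "Qi i = \<dots>" .
    then have "aw_weight (a^2) (c^2) (x i) * poly (Qi i) (jouk (t * x i)) +
      aw_weight (a^2) (c^2) (1 / x i) * poly (Qi i) (jouk (x i / t)) =
      (\<Sum>k\<le>n. s k * e k * (aw_weight (a^2) (c^2) (x i) * poly (synthetic_div (p k) (y i)) (jouk (t * x i)) +
      aw_weight (a^2) (c^2) (1 / x i) * poly (synthetic_div (p k) (y i)) (jouk (x i / t))))"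
      by (simp add: poly_sum sum_distrib_left ring_distribs sum.distrib mult.left_commute mult.assoc)
    also have "\<dots> = (\<Sum>k\<le>n. s k * e k * (l t k * poly (p k) (y i)))"
      unfolding y_def p_def l_def
      by (intro sum.cong refl arg_cong2[where f = "(*)"] aw_orth_poly[where n = n])
         (use x nz \<phi> rec in \<open>auto simp: l_def\<close>)
    finally show ?thesis by (simp add: R_def poly_sum mult.assoc)
  qed
  \<comment> \<open>Interpolation at n nodes recovers only polynomials of degree below n, whereas R
    may have degree n. Subtracting \<open>l t n\<close> times Q removes the top coefficient and
    changes no value at the nodes. This is the origin of the term \<open>l t n\<close> in the
    eigenvalue.\<close>
  have S: "(\<Sum>i=1..n. smult (poly R (y i) / (\<Prod>j\<in>{1..n} - {i}. y i - y j)) (Qi i)) = R - smult (l t n) Q"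
  proof -
    have RQ: "R - smult (l t n) Q = (\<Sum>k\<le>n. smult (s k * e k * (l t k - l t n)) (p k))"
      unfolding R_def Q smult_sum_right sum_subtractf[symmetric]
      by (intro sum.cong refl) (simp add: algebra_simps smult_diff_left[symmetric])
    have "coeff (R - smult (l t n) Q) j = 0" if "card {1..n} \<le> j" for j
      unfolding RQ coeff_sum
    proof (intro sum.neutral ballI)
      fix k assume "k \<in> {..n}"
      then show "coeff (smult (s k * e k * (l t k - l t n)) (p k)) j = 0"
        using that by (cases "k = n") (auto simp: p_def coeff_orth_poly)
    qed
    then have "R - smult (l t n) Q =
      (\<Sum>i=1..n. smult (poly (R - smult (l t n) Q) (y i) / (\<Prod>j\<in>{1..n} - {i}. y i - y j)) (Qi i))"
      unfolding Qi_def by (intro lagrange_interpolation inj) auto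
    also have "\<dots> = (\<Sum>i=1..n. smult (poly R (y i) / (\<Prod>j\<in>{1..n} - {i}. y i - y j)) (Qi i))"
    proof (intro sum.cong refl)
      fix i assume "i \<in> {1..n}"
      then have "poly Q (y i) = 0" by (simp add: Q_split)
      then show "smult (poly (R - smult (l t n) Q) (y i) / (\<Prod>j\<in>{1..n} - {i}. y i - y j)) (Qi i) =
        smult (poly R (y i) / (\<Prod>j\<in>{1..n} - {i}. y i - y j)) (Qi i)" by simp
    qed
    finally show ?thesis by simp
  qed
  let ?V = "kw_coeff a (-a) c (-c) q t \<alpha> n x"
  have res: "?V i (x i) * (y i - jouk (q * x i)) + ?V i (1 / x i) * (y i - jouk (x i / q)) =
    - \<kappa> * (poly R (y i) / (\<Prod>j\<in>{1..n} - {i}. y i - y j))" if i: "i \<in> {1..n}" for i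
  proof -
    have P: "poly (Qi i) X = (\<Prod>j\<in>{1..n} - {i}. X - jouk (x j))" for X
      by (simp add: Qi_def poly_prod y_def)
    have "?V i (x i) * (y i - jouk (q * x i)) =
      - \<kappa> * (aw_weight (a^2) (c^2) (x i) * poly (Qi i) (jouk (t * x i))) / (\<Prod>j\<in>{1..n} - {i}. y i - y j)"
      unfolding y_def \<kappa>_def P by (rule kw_coeff_times_shift) (use x nz i in auto)
    moreover have "jouk (x i / q) = jouk (q * (1 / x i))" "jouk (x i / t) = jouk (t * (1 / x i))"
      "y i = jouk (1 / x i)"
      using jouk_inverse[of "x i / q"] jouk_inverse[of "x i / t"] jouk_inverse[of "x i"] by (simp_all add: y_def)
    then have "?V i (1 / x i) * (y i - jouk (x i / q)) =
      - \<kappa> * (aw_weight (a^2) (c^2) (1 / x i) * poly (Qi i) (jouk (x i / t))) / (\<Prod>j\<in>{1..n} - {i}. y i - y j)"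
      using kw_coeff_times_shift[of "1 / x i" q t \<alpha> x i n a c] x nz i not_sym[OF x(4)[of i]]
      unfolding \<kappa>_def P by (simp add: y_def power_divide)
    ultimately show ?thesis unfolding numer[OF i, symmetric]
      by (simp add: add_divide_distrib ring_distribs)
  qed
  have lin: "(\<Sum>k\<le>n. smult (s k * (\<Sum>i=1..n. V i * f i k)) (p k)) =
    (\<Sum>i=1..n. smult (V i) (\<Sum>k\<le>n. smult (s k * f i k) (p k)))" for V :: "nat \<Rightarrow> 'a" and f
    unfolding smult_sum_right sum_distrib_left smult_sum smult_smult
    by (subst sum.swap) (simp only: mult.left_commute)
  have "(\<Sum>k\<le>n. smult (s k * ?D k) (p k)) =
    (\<Sum>i=1..n. smult (?V i (x i)) (\<Sum>k\<le>n. smult (s k * (column_poly \<phi> (y(i := jouk (q * x i))) n k - e k)) (p k))) +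
    (\<Sum>i=1..n. smult (?V i (1 / x i)) (\<Sum>k\<le>n. smult (s k * (column_poly \<phi> (y(i := jouk (x i / q))) n k - e k)) (p k)))"
    unfolding lin[symmetric] e_def distrib_left smult_add_left sum.distrib ..
  also have "\<dots> = (\<Sum>i=1..n. smult (?V i (x i) * (y i - jouk (q * x i)) + ?V i (1 / x i) * (y i - jouk (x i / q))) (Qi i))"
    unfolding sum.distrib[symmetric] by (intro sum.cong refl) (simp add: shift smult_add_left)
  also have "\<dots> = smult (- \<kappa>) (\<Sum>i=1..n. smult (poly R (y i) / (\<Prod>j\<in>{1..n} - {i}. y i - y j)) (Qi i))"
    unfolding smult_sum_right smult_smult by (intro sum.cong refl) (simp only: res)
  also have "\<dots> = (\<Sum>k\<le>n. smult (s k * (\<kappa> * (l t n - l t k) * e k)) (p k))"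
    unfolding S unfolding R_def Q smult_sum_right sum_subtractf[symmetric] smult_smult smult_diff_left[symmetric]
    by (intro sum.cong refl arg_cong2[where f = smult]) (simp add: algebra_simps)
  finally have "(\<Sum>k\<le>n. smult (s k * ?D k - s k * (\<kappa> * (l t n - l t k) * e k)) (p k)) = 0"
    by (simp only: smult_diff_left sum_subtractf diff_self)
  then have "s k * ?D k - s k * (\<kappa> * (l t n - l t k) * e k) = 0"
    unfolding p_def by (rule orth_poly_independent) fact
  then have "s k * ?D k = s k * (\<kappa> * (l t n - l t k) * e k)" by simp
  moreover have "s k \<noteq> 0" by (simp add: s_def)
  ultimately show ?thesis by (simp only: mult_cancel_left e_def \<kappa>_def) blast
qed


section \<open>Laurent polynomials and one-column orbit sums\<close>

abbreviation (input) lkp :: "('a \<Rightarrow>\<^sub>0 'b::zero) \<Rightarrow> 'a \<Rightarrow> 'b" where "lkp \<equiv> Poly_Mapping.lookup"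

lemma emb_0: "emb 0 = 0" and emb_1: "emb 1 = 1"
  and emb_add: "emb (p + q) = emb p + emb q"
  and emb_diff: "emb (p - q) = emb p - emb q"
  and emb_minus: "emb (- p) = - emb p"
  and emb_mult: "emb (p * q) = emb p * emb q"
  by (simp_all add: emb_def fract_expand)

lemma emb_inject: "emb p = emb q \<longleftrightarrow> p = q"
  by (simp add: emb_def eq_fract)

lemma emb_sum: "emb (\<Sum>i\<in>I. f i) = (\<Sum>i\<in>I. emb (f i))"
  by (induction I rule: infinite_finite_induct) (auto simp: emb_0 emb_add)

lemma const_laurent_0: "const_laurent 0 = 0" and const_laurent_1: "const_laurent 1 = 1"
  and const_laurent_add: "const_laurent (w + z) = const_laurent w + const_laurent z"
  and const_laurent_mult: "const_laurent (w * z) = const_laurent w * const_laurent z"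
  and const_laurent_minus: "const_laurent (- z) = - const_laurent z"
  and const_laurent_diff: "const_laurent (w - z) = const_laurent w - const_laurent z"
  by (simp_all add: const_laurent_def Poly_Mapping.single_add mult_single single_uminus single_diff)

lemma cst_0: "cst 0 = 0" and cst_1: "cst 1 = 1" and cst_add: "cst (w + z) = cst w + cst z"
  and cst_mult: "cst (w * z) = cst w * cst z" and cst_minus: "cst (- z) = - cst z"
  and cst_diff: "cst (w - z) = cst w - cst z"
  by (simp_all add: cst_def emb_0 emb_1 emb_add emb_mult emb_minus emb_diff const_laurent_0
      const_laurent_1 const_laurent_add const_laurent_mult const_laurent_minus const_laurent_diff)

lemma cst_eq_0_iff: "cst z = 0 \<longleftrightarrow> z = 0"
  by (metis Poly_Mapping.lookup_single_eq const_laurent_0 const_laurent_def cst_def emb_0 emb_inject)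

lemma cst_inject: "cst w = cst z \<longleftrightarrow> w = z"
  using cst_eq_0_iff[of "w - z"] by (simp add: cst_diff)

lemma cst_divide: "cst (w / z) = cst w / cst z"
proof (cases "z = 0")
  case False
  then have "cst (w / z) * cst z = cst w" by (simp flip: cst_mult)
  then show ?thesis using False by (simp add: cst_eq_0_iff eq_divide_eq)
qed (simp add: cst_0)

lemma cst_power: "cst (z ^ k) = cst z ^ k"
  by (induction k) (auto simp: cst_1 cst_mult)

lemma cst_sum: "cst (\<Sum>i\<in>I. f i) = (\<Sum>i\<in>I. cst (f i))"
  by (induction I rule: infinite_finite_induct) (auto simp: cst_0 cst_add)

lemma cst_catalan: "cst (catalan \<phi> i j) = catalan (\<lambda>k. cst (\<phi> k)) i j"
  by (induction \<phi> i j rule: catalan.induct) (auto simp: cst_0 cst_1 cst_add cst_mult)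

lemma cst_aw_eigenvalue: "cst (aw_eigenvalue P t k) = aw_eigenvalue (cst P) (cst t) k"
  by (simp add: aw_eigenvalue_def cst_sum cst_diff cst_divide cst_1 cst_mult cst_power)

lemma lookup_scale_var:
  "lkp (scale_var u i p) \<mu> = u powi (lkp \<mu> i) * lkp p \<mu>"
  by (simp add: scale_var_def lookup_mapp when_def not_in_keys_iff_lookup_eq_zero)

lemma scale_var_add: "scale_var u i (p + q) = scale_var u i p + scale_var u i q"
  by (rule poly_mapping_eqI) (simp add: lookup_scale_var lookup_add ring_distribs)

lemma scale_var_0: "scale_var u i 0 = 0"
  by (rule poly_mapping_eqI) (simp add: lookup_scale_var)

lemma scale_var_1: "scale_var u i 1 = 1"
  by (rule poly_mapping_eqI) (simp add: lookup_scale_var lookup_one when_def)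

lemma scale_var_sum: "scale_var u i (\<Sum>j\<in>I. f j) = (\<Sum>j\<in>I. scale_var u i (f j))"
  by (induction I rule: infinite_finite_induct) (auto simp: scale_var_add scale_var_0)

lemma scale_var_single:
  "scale_var u i (Poly_Mapping.single \<mu> z) = Poly_Mapping.single \<mu> (u powi (lkp \<mu> i) * z)"
  by (rule poly_mapping_eqI) (auto simp: lookup_scale_var lookup_single when_def)

lemma poly_mapping_eq_sum_single:
  "p = (\<Sum>\<mu>\<in>Poly_Mapping.keys p. Poly_Mapping.single \<mu> (lkp p \<mu>))"
  by (rule poly_mapping_eqI)
     (simp add: lookup_sum lookup_single when_def not_in_keys_iff_lookup_eq_zero)

text \<open>On monomials this is additivity of \<open>powi\<close> in the exponent, valid for
  nonzero u; bilinearity does the rest.\<close>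

lemma scale_var_mult:
  assumes "u \<noteq> 0"
  shows "scale_var u i (p * q) = scale_var u i p * scale_var u i q"
proof -
  let ?s = "\<lambda>p \<mu>. Poly_Mapping.single \<mu> (lkp p \<mu>)"
  have "scale_var u i ((\<Sum>\<mu>\<in>Poly_Mapping.keys p. ?s p \<mu>) * (\<Sum>\<mu>\<in>Poly_Mapping.keys q. ?s q \<mu>)) =
    scale_var u i (\<Sum>\<mu>\<in>Poly_Mapping.keys p. ?s p \<mu>) * scale_var u i (\<Sum>\<mu>\<in>Poly_Mapping.keys q. ?s q \<mu>)"
    unfolding sum_product scale_var_sum
    by (intro sum.cong refl)
       (simp add: mult_single scale_var_single lookup_add power_int_add assms ac_simps)
  then show ?thesis
    using poly_mapping_eq_sum_single[of p] poly_mapping_eq_sum_single[of q] by simp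
qed

lemma scale_var_const: "scale_var u i (const_laurent z) = const_laurent z"
  by (simp add: const_laurent_def scale_var_single)

definition Yvar :: "nat \<Rightarrow> laurent" where
  "Yvar i = Poly_Mapping.single (Poly_Mapping.single i 1) 1 + Poly_Mapping.single (Poly_Mapping.single i (-1)) 1"

lemma Xvar_power: "Xvar i ^ k = emb (Poly_Mapping.single (Poly_Mapping.single i (int k)) 1)"
  by (induction k) (auto simp: emb_1 Xvar_def emb_mult[symmetric] mult_single Poly_Mapping.single_add[symmetric])

lemma Xvar_nonzero: "Xvar i \<noteq> 0"
  by (metis Xvar_def Poly_Mapping.lookup_single_eq Poly_Mapping.lookup_zero emb_0 emb_inject zero_neq_one)

lemma inverse_Xvar: "1 / Xvar i = emb (Poly_Mapping.single (Poly_Mapping.single i (-1)) 1)"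
proof -
  have "emb (Poly_Mapping.single (Poly_Mapping.single i (-1)) 1) * Xvar i = 1"
    by (simp add: Xvar_def emb_mult[symmetric] mult_single Poly_Mapping.single_add[symmetric] emb_1)
  then show ?thesis using Xvar_nonzero[of i] by (simp add: eq_divide_eq divide_eq_eq)
qed

text \<open>Used with (u, v) equal to (1, 1), (1, q) and (q, 1), it keeps the denominators of the
  operator nonzero in the fraction field.\<close>

lemma Xvar_square_neq:
  assumes "u \<noteq> 0"
  shows "cst u * Xvar i ^ 2 \<noteq> cst v"
proof
  assume "cst u * Xvar i ^ 2 = cst v"
  then have "Poly_Mapping.single (Poly_Mapping.single i 2) u = Poly_Mapping.single (0 :: exponent) v"
    by (simp add: Xvar_power cst_def emb_mult[symmetric] const_laurent_def mult_single emb_inject)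
  from arg_cong[OF this, of "\<lambda>p. lkp p (Poly_Mapping.single i 2)"]
  have "lkp (Poly_Mapping.single (0 :: exponent) v) (Poly_Mapping.single i 2) = u"
    by (simp only: lookup_single_eq)
  moreover have "(Poly_Mapping.single i 2 :: exponent) \<noteq> 0"
    by (metis Poly_Mapping.lookup_single_eq Poly_Mapping.lookup_zero zero_neq_numeral)
  ultimately show False using assms by (simp add: lookup_single when_def split: if_splits)
qed

lemma jouk_Xvar: "jouk (Xvar i) = emb (Yvar i)"
  by (simp add: jouk_def inverse_Xvar Yvar_def emb_add) (simp add: Xvar_def)

lemma emb_scale_Yvar:
  assumes "u \<noteq> 0"
  shows "emb (scale_var u i (Yvar j)) = (if j = i then jouk (cst u * Xvar i) else emb (Yvar j))"
proof -
  have "1 / (cst u * Xvar i) = cst (1 / u) * (1 / Xvar i)" by (simp add: cst_divide cst_1)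
  then have "jouk (cst u * Xvar i) = cst u * Xvar i + cst (1 / u) * (1 / Xvar i)"
    by (simp add: jouk_def)
  also have "\<dots> = emb (Poly_Mapping.single (Poly_Mapping.single i 1) u +
      Poly_Mapping.single (Poly_Mapping.single i (-1)) (1 / u))"
    unfolding inverse_Xvar
    by (simp add: Xvar_def cst_def emb_add[symmetric] emb_mult[symmetric] const_laurent_def mult_single)
  finally show ?thesis
    by (auto simp: Yvar_def scale_var_add scale_var_single lookup_single power_int_minus divide_inverse)
qed

lemma Yvar_inject: "Yvar i = Yvar j \<longleftrightarrow> i = j"
proof
  have eq: "i = j" if "Poly_Mapping.single j e = Poly_Mapping.single i (1 :: int)" for e
    using arg_cong[OF that, of "\<lambda>p. lkp p i"] by (auto simp: lookup_single when_def split: if_splits)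
  assume "Yvar i = Yvar j"
  then have "lkp (Yvar i) (Poly_Mapping.single i 1) = lkp (Yvar j) (Poly_Mapping.single i 1)" by simp
  moreover have "lkp (Yvar i) (Poly_Mapping.single i 1) \<noteq> 0"
    by (auto simp: Yvar_def lookup_add lookup_single when_def)
  moreover have "lkp (Yvar j) (Poly_Mapping.single i 1) = 0" if "i \<noteq> j"
    using eq that by (auto simp: Yvar_def lookup_add lookup_single when_def simp del: single_uminus)
  ultimately show "i = j" by metis
qed simp

section \<open>One-column orbit sums as elementary symmetric polynomials\<close>

lemma lookup_single_mult:
  fixes p :: laurent
  shows "lkp (Poly_Mapping.single \<nu> 1 * p) \<mu> = lkp p (\<mu> - \<nu>)"
proof -
  have "(\<mu> = l + q) = (q = \<mu> - l)" for l q :: exponent by auto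
  then show ?thesis
    by (simp add: lookup_mult lookup_single when_def[symmetric] mult_when when_mult)
qed

text \<open>An explicit description of the orbit of (1^r). Unlike the orbit relation, it can be
  split on the last entry, which matches the recursion of \<open>esym\<close>.\<close>

definition column_shape :: "nat \<Rightarrow> nat \<Rightarrow> exponent \<Rightarrow> bool" where
  "column_shape n r \<mu> \<longleftrightarrow> Poly_Mapping.keys \<mu> \<subseteq> {1..n} \<and> (\<forall>i. lkp \<mu> i \<in> {-1, 0, 1}) \<and>
     card (Poly_Mapping.keys \<mu>) = r"

lemma column_shape_Suc:
  "column_shape (Suc n) r \<mu> \<longleftrightarrow>
     (lkp \<mu> (Suc n) = 0 \<and> column_shape n r \<mu>) \<or>
     (\<exists>s. r = Suc s \<and> (\<exists>e\<in>{1, -1}. lkp \<mu> (Suc n) = e \<and>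
        column_shape n s (\<mu> - Poly_Mapping.single (Suc n) e)))" (is "_ \<longleftrightarrow> ?R")
proof (cases "lkp \<mu> (Suc n) = 0")
  case True
  then have "Poly_Mapping.keys \<mu> \<subseteq> {1..Suc n} \<longleftrightarrow> Poly_Mapping.keys \<mu> \<subseteq> {1..n}"
    by (auto simp: in_keys_iff subset_iff) (metis le_Suc_eq)
  then show ?thesis using True by (auto simp: column_shape_def)
next
  case False
  let ?\<nu> = "\<mu> - Poly_Mapping.single (Suc n) (lkp \<mu> (Suc n))"
  have l: "lkp ?\<nu> i = (if i = Suc n then 0 else lkp \<mu> i)" for i
    by (simp add: lookup_minus lookup_single when_def)
  have k: "Poly_Mapping.keys \<mu> = insert (Suc n) (Poly_Mapping.keys ?\<nu>)" "Suc n \<notin> Poly_Mapping.keys ?\<nu>"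
    using False by (auto simp: in_keys_iff l split: if_splits)
  have "Poly_Mapping.keys \<mu> \<subseteq> {1..Suc n} \<longleftrightarrow> Poly_Mapping.keys ?\<nu> \<subseteq> {1..n}"
    using k(2) unfolding k(1) by (auto simp: subset_iff) (metis le_Suc_eq)
  moreover have "card (Poly_Mapping.keys \<mu>) = Suc (card (Poly_Mapping.keys ?\<nu>))"
    using k(2) unfolding k(1) by simp
  moreover have "(\<forall>i. lkp \<mu> i \<in> {-1, 0, 1}) \<longleftrightarrow>
      lkp \<mu> (Suc n) \<in> {-1, 1} \<and> (\<forall>i. lkp ?\<nu> i \<in> {-1, 0, 1})"
  proof -
    have 1: "(\<forall>i. lkp ?\<nu> i \<in> {-1, 0, 1}) \<longleftrightarrow> (\<forall>i. i \<noteq> Suc n \<longrightarrow> lkp \<mu> i \<in> {-1, 0, 1})"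
      unfolding l by auto
    have 2: "lkp \<mu> (Suc n) \<in> {-1, 1} \<longleftrightarrow> lkp \<mu> (Suc n) \<in> {-1, 0, 1}" using False by auto
    have "(\<forall>i. lkp \<mu> i \<in> {-1, 0, 1}) \<longleftrightarrow>
      lkp \<mu> (Suc n) \<in> {-1, 0, 1} \<and> (\<forall>i. i \<noteq> Suc n \<longrightarrow> lkp \<mu> i \<in> {-1, 0, 1})" by metis
    then show ?thesis unfolding 1 2 .
  qed
  ultimately show ?thesis using False unfolding column_shape_def by auto
qed

text \<open>Multiplying out a product of r distinct y_i produces each choice of signs once. In the
  induction the last entry 0, 1 or -1 selects one of three terms, and these cases exclude each
  other, so no coefficient exceeds 1.\<close>

lemma lookup_esym_Yvar: "lkp (esym Yvar n r) \<mu> = (if column_shape n r \<mu> then 1 else 0)"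
proof (induction Yvar n r arbitrary: \<mu> rule: esym.induct)
  case (1 r)
  then show ?case by (auto simp: column_shape_def lookup_one when_def)
next
  case (2 n)
  then show ?case by (auto simp: column_shape_Suc)  (auto simp: column_shape_def)
next
  case (3 n r)
  have "\<not> column_shape n s \<nu>" if "lkp \<nu> (Suc n) \<noteq> 0" for \<nu> s
    using that by (auto simp: column_shape_def in_keys_iff subset_iff)
  then have zero: "column_shape n s \<nu> \<Longrightarrow> lkp \<nu> (Suc n) = 0" for \<nu> s by blast
  have "lkp (\<mu> - Poly_Mapping.single (Suc n) e) (Suc n) = lkp \<mu> (Suc n) - e" for e
    by (simp add: lookup_minus)
  then have "column_shape n r (\<mu> - Poly_Mapping.single (Suc n) e) \<Longrightarrow> lkp \<mu> (Suc n) = e" for e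
    using zero[of r "\<mu> - Poly_Mapping.single (Suc n) e"] by simp
  note e = this and e0 = zero[of "Suc r" \<mu>]
  let ?c = "\<lambda>s \<nu>. if column_shape n s \<nu> then 1 else (0::complex)"
  have "lkp (esym Yvar (Suc n) (Suc r)) \<mu> = ?c (Suc r) \<mu> + (?c r (\<mu> - Poly_Mapping.single (Suc n) 1) +
      ?c r (\<mu> - Poly_Mapping.single (Suc n) (-1)))"
    unfolding esym.simps lookup_add distrib_right Yvar_def lookup_single_mult 3(1) 3(2)[folded Yvar_def] ..
  also have "\<dots> = (if column_shape (Suc n) (Suc r) \<mu> then 1 else 0)"
    unfolding column_shape_Suc using e[of 1] e[of "-1"] e0
    by (simp del: single_uminus) (metis one_neq_neg_one zero_neq_neg_one zero_neq_one)
  finally show ?case .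
qed

lemma lookup_one_column: "lkp (one_column r) i = (if 1 \<le> i \<and> i \<le> r then 1 else 0)"
  by (auto simp: one_column_def lookup_sum lookup_single when_def)

lemma weyl_conj_column_shape:
  assumes "weyl_conj n \<mu> \<nu>"
  shows "column_shape n r \<nu> \<longleftrightarrow> column_shape n r \<mu>"
proof -
  obtain \<sigma> \<epsilon> where \<sigma>: "\<sigma> permutes {1..n}" and \<epsilon>: "\<forall>i\<in>{1..n}. \<epsilon> i \<in> {1, -1 :: int}"
    and \<nu>: "\<forall>i\<in>{1..n}. lkp \<nu> i = \<epsilon> i * lkp \<mu> (\<sigma> i)" "\<forall>i. i \<notin> {1..n} \<longrightarrow> lkp \<nu> i = lkp \<mu> i"
    using assms unfolding weyl_conj_def by blast
  have \<nu>': "lkp \<nu> i = lkp \<mu> (\<sigma> i) \<or> lkp \<nu> i = - lkp \<mu> (\<sigma> i)" for i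
    using \<nu> \<epsilon> permutes_not_in[OF \<sigma>] by (cases "i \<in> {1..n}") fastforce+
  have in\<sigma>: "\<sigma> i \<in> {1..n} \<longleftrightarrow> i \<in> {1..n}" for i using permutes_in_image[OF \<sigma>] .
  have k: "i \<in> Poly_Mapping.keys \<nu> \<longleftrightarrow> \<sigma> i \<in> Poly_Mapping.keys \<mu>" for i
    using \<nu>'[of i] by (auto simp: in_keys_iff)
  have surj: "\<exists>j. i = \<sigma> j" for i using permutes_surj[OF \<sigma>] by (auto simp: surj_def)
  then have all: "(\<forall>i. Q i) \<longleftrightarrow> (\<forall>i. Q (\<sigma> i))" for Q by metis
  have "Poly_Mapping.keys \<mu> = \<sigma> ` Poly_Mapping.keys \<nu>"
  proof (intro set_eqI iffI)
    fix i assume "i \<in> Poly_Mapping.keys \<mu>"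
    moreover obtain j where "i = \<sigma> j" using surj by blast
    ultimately show "i \<in> \<sigma> ` Poly_Mapping.keys \<nu>" using k by simp
  qed (use k in auto)
  then have "card (Poly_Mapping.keys \<mu>) = card (Poly_Mapping.keys \<nu>)"
    using permutes_inj[OF \<sigma>] by (simp add: card_image inj_on_subset)
  moreover have "Poly_Mapping.keys \<nu> \<subseteq> {1..n} \<longleftrightarrow> Poly_Mapping.keys \<mu> \<subseteq> {1..n}"
    unfolding subset_iff k all[of "\<lambda>i. i \<in> Poly_Mapping.keys \<mu> \<longrightarrow> i \<in> {1..n}"] in\<sigma> ..
  moreover have "lkp \<nu> i \<in> {-1, 0, 1} \<longleftrightarrow> lkp \<mu> (\<sigma> i) \<in> {-1, 0, 1}" for i
    using \<nu>'[of i] by auto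
  then have "(\<forall>i. lkp \<nu> i \<in> {-1, 0, 1}) \<longleftrightarrow> (\<forall>i. lkp \<mu> i \<in> {-1, 0, 1})"
    unfolding all[of "\<lambda>i. lkp \<mu> i \<in> {-1, 0, 1}"] by simp
  ultimately show ?thesis unfolding column_shape_def by metis
qed

lemma weyl_conj_one_column:
  assumes "r \<le> n"
  shows "weyl_conj n (one_column r) \<mu> \<longleftrightarrow> column_shape n r \<mu>"
proof
  have keys: "Poly_Mapping.keys (one_column r) = {1..r}"
    by (auto simp: in_keys_iff lookup_one_column split: if_splits)
  then have "column_shape n r (one_column r)"
    using assms by (auto simp: column_shape_def lookup_one_column)
  then show "weyl_conj n (one_column r) \<mu> \<Longrightarrow> column_shape n r \<mu>"
    using weyl_conj_column_shape by blast
  assume shape: "column_shape n r \<mu>"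
  let ?K = "Poly_Mapping.keys \<mu>"
  have K: "?K \<subseteq> {1..n}" "card ?K = r" using shape by (auto simp: column_shape_def)
  obtain f where f: "bij_betw f ?K {1..r}"
    using finite_same_card_bij[of ?K "{1..r}"] K by auto
  have "card ({1..n} - ?K) = card ({1..n} - {1..r})"
    using K assms by (simp add: card_Diff_subset)
  then obtain g where g: "bij_betw g ({1..n} - ?K) ({1..n} - {1..r})"
    using finite_same_card_bij[of "{1..n} - ?K" "{1..n} - {1..r}"] by auto
  \<comment> \<open>The permutation carries the support of \<open>\<mu>\<close> to {1..r} and the
    complement to the complement; the signs of \<open>\<mu>\<close> are then supplied by
    \<open>\<epsilon>\<close>.\<close>
  define \<sigma> where "\<sigma> i = (if i \<in> ?K then f i else if i \<in> {1..n} then g i else i)" for i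
  have "bij_betw \<sigma> (?K \<union> ({1..n} - ?K)) ({1..r} \<union> ({1..n} - {1..r}))"
  proof (rule bij_betw_combine)
    show "bij_betw \<sigma> ?K {1..r}" using f by (rule bij_betw_cong[THEN iffD1, rotated]) (simp add: \<sigma>_def)
    show "bij_betw \<sigma> ({1..n} - ?K) ({1..n} - {1..r})"
      using g by (rule bij_betw_cong[THEN iffD1, rotated]) (simp add: \<sigma>_def)
  qed auto
  moreover have "?K \<union> ({1..n} - ?K) = {1..n}" "{1..r} \<union> ({1..n} - {1..r}) = {1..n}" using K assms by auto
  ultimately have "bij_betw \<sigma> {1..n} {1..n}" by simp
  then have \<sigma>: "\<sigma> permutes {1..n}"
    by (rule bij_imp_permutes) (use K in \<open>auto simp: \<sigma>_def\<close>)
  have \<sigma>r: "\<sigma> i \<in> {1..r} \<longleftrightarrow> i \<in> ?K" if "i \<in> {1..n}" for i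
    using bij_betwE[OF f] bij_betwE[OF g] that by (auto simp: \<sigma>_def)
  define \<epsilon> where "\<epsilon> i = (if lkp \<mu> i = -1 then -1 else 1 :: int)" for i
  have "lkp \<mu> i = \<epsilon> i * lkp (one_column r) (\<sigma> i)" if "i \<in> {1..n}" for i
  proof -
    have "lkp \<mu> i \<in> {-1, 0, 1}" using shape by (simp add: column_shape_def)
    then show ?thesis using \<sigma>r[OF that] by (auto simp: \<epsilon>_def lookup_one_column in_keys_iff)
  qed
  moreover have "lkp \<mu> i = lkp (one_column r) i" if "i \<notin> {1..n}" for i
    using that K assms by (auto simp: lookup_one_column in_keys_iff subset_iff)
  moreover have "\<forall>i\<in>{1..n}. \<epsilon> i \<in> {1, -1}" by (simp add: \<epsilon>_def)
  ultimately show "weyl_conj n (one_column r) \<mu>"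
    unfolding weyl_conj_def using \<sigma> by blast
qed

lemma orbit_sum_one_column:
  assumes "r \<le> n"
  shows "orbit_sum n (one_column r) = esym Yvar n r"
proof (rule poly_mapping_eqI)
  fix \<nu>
  have "{\<mu>. column_shape n r \<mu>} = Poly_Mapping.keys (esym Yvar n r)"
    by (auto simp: in_keys_iff lookup_esym_Yvar split: if_splits)
  then have "finite {\<mu>. column_shape n r \<mu>}" by simp
  then show "lkp (orbit_sum n (one_column r)) \<nu> = lkp (esym Yvar n r) \<nu>"
    by (simp add: orbit_sum_def weyl_conj_one_column[OF assms] lookup_sum lookup_single lookup_esym_Yvar
        when_def)
qed

lemma koornwinder_op_kw_coeff:
  "koornwinder_op n a b c d q t p =
    (\<Sum>i=1..n. kw_coeff (cst a) (cst b) (cst c) (cst d) (cst q) (cst t) (cst (alpha a b c d q)) n Xvar i (Xvar i)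
        * emb (scale_var q i p - p)) +
    (\<Sum>i=1..n. kw_coeff (cst a) (cst b) (cst c) (cst d) (cst q) (cst t) (cst (alpha a b c d q)) n Xvar i (1 / Xvar i)
        * emb (scale_var (inverse q) i p - p))"
proof -
  have "(\<Prod>j\<in>{1..n} - {i}. (1 - cst t * Xvar j / Xvar i) * (1 - cst t / (Xvar i * Xvar j)) /
          ((1 - Xvar j / Xvar i) * (1 - 1 / (Xvar i * Xvar j)))) =
     (\<Prod>j\<in>{1..n} - {i}. (1 - cst t * (1 / Xvar i) * Xvar j) * (1 - cst t * (1 / Xvar i) / Xvar j) /
          ((1 - (1 / Xvar i) * Xvar j) * (1 - (1 / Xvar i) / Xvar j)))" for i
    by (intro prod.cong refl) (simp add: field_simps)
  then show ?thesis
    unfolding koornwinder_op_def kw_coeff_def by (simp add: power_divide)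
qed


section \<open>One-column Koornwinder polynomials\<close>

lemma koornwinder_op_add:
  "koornwinder_op n a b c d q t (p + p') = koornwinder_op n a b c d q t p + koornwinder_op n a b c d q t p'"
proof -
  have "emb (scale_var u i (p + p') - (p + p')) = emb (scale_var u i p - p) + emb (scale_var u i p' - p')" for u i
    by (simp add: scale_var_add emb_add[symmetric] algebra_simps)
  then show ?thesis
    unfolding koornwinder_op_kw_coeff by (simp only: distrib_left sum.distrib) (simp only: ac_simps)
qed

lemma scale_var_const_mult: "u \<noteq> 0 \<Longrightarrow> scale_var u i (const_laurent z * p) = const_laurent z * scale_var u i p"
  by (simp add: scale_var_mult scale_var_const)

lemma koornwinder_op_const_mult:
  assumes "q \<noteq> 0"
  shows "koornwinder_op n a b c d q t (const_laurent z * p) = cst z * koornwinder_op n a b c d q t p"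
proof -
  have "emb (scale_var u i (const_laurent z * p) - const_laurent z * p) = cst z * emb (scale_var u i p - p)"
    if "u \<noteq> 0" for u i
    by (simp add: scale_var_const_mult[OF that] cst_def emb_mult[symmetric] right_diff_distrib)
  then show ?thesis
    using assms unfolding koornwinder_op_kw_coeff
    by (simp add: distrib_left sum_distrib_left mult.left_commute)
qed

lemma koornwinder_op_0: "koornwinder_op n a b c d q t 0 = 0"
  by (simp add: koornwinder_op_kw_coeff scale_var_0 emb_0)

lemma koornwinder_op_sum:
  "koornwinder_op n a b c d q t (\<Sum>i\<in>I. f i) = (\<Sum>i\<in>I. koornwinder_op n a b c d q t (f i))"
  by (induction I rule: infinite_finite_induct) (auto simp: koornwinder_op_0 koornwinder_op_add)

definition column_laurent :: "(nat \<Rightarrow> complex) \<Rightarrow> nat \<Rightarrow> nat \<Rightarrow> laurent" where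
  "column_laurent \<phi> n k =
     (\<Sum>j\<le>n. const_laurent (catalan \<phi> k j) * orbit_sum n (one_column (n - j)))"

text \<open>Stated for a general homomorphism because it serves twice: for \<open>emb\<close>, and
  for \<open>emb\<close> after \<open>scale_var\<close>, which merely replaces one y_i by its
  shifted value.\<close>

lemma hom_column_laurent:
  fixes h :: "laurent \<Rightarrow> laurent fract"
  assumes h: "h 1 = 1" "h 0 = 0" "\<And>a b. h (a + b) = h a + h b" "\<And>a b. h (a * b) = h a * h b"
    and const: "\<And>z. h (const_laurent z) = cst z"
  shows "h (column_laurent \<phi> n k) = column_poly (\<lambda>k. cst (\<phi> k)) (\<lambda>i. h (Yvar i)) n k"
proof -
  have sum: "h (\<Sum>i\<in>I. f i) = (\<Sum>i\<in>I. h (f i))" if "finite I" for f and I :: "nat set"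
    using that by (induction I rule: finite_induct) (auto simp: h)
  show ?thesis
    by (simp add: column_laurent_def column_poly_def sum h(4) const cst_catalan orbit_sum_one_column
        esym_hom[of h, OF h])
qed

lemma emb_column_laurent:
  "emb (column_laurent \<phi> n k) = column_poly (\<lambda>k. cst (\<phi> k)) (\<lambda>i. jouk (Xvar i)) n k"
  unfolding jouk_Xvar by (rule hom_column_laurent) (simp_all add: emb_1 emb_0 emb_add emb_mult cst_def)

lemma emb_scale_column_laurent:
  assumes "u \<noteq> 0"
  shows "emb (scale_var u i (column_laurent \<phi> n k)) =
    column_poly (\<lambda>k. cst (\<phi> k)) ((\<lambda>i. jouk (Xvar i))(i := jouk (cst u * Xvar i))) n k"
proof -
  have "emb (scale_var u i (column_laurent \<phi> n k)) =
      column_poly (\<lambda>k. cst (\<phi> k)) (\<lambda>j. emb (scale_var u i (Yvar j))) n k"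
    by (rule hom_column_laurent)
       (simp_all add: emb_1 emb_0 emb_add emb_mult scale_var_1 scale_var_0 scale_var_add scale_var_mult
         scale_var_const assms cst_def)
  also have "(\<lambda>j. emb (scale_var u i (Yvar j))) = (\<lambda>i. jouk (Xvar i))(i := jouk (cst u * Xvar i))"
    by (auto simp: fun_eq_iff emb_scale_Yvar[OF assms] jouk_Xvar)
  finally show ?thesis .
qed

definition column_eigenvalue :: "complex \<Rightarrow> complex \<Rightarrow> complex \<Rightarrow> complex \<Rightarrow> nat \<Rightarrow> nat \<Rightarrow> complex" where
  "column_eigenvalue a c q t n k = (1 - q) / (q * alpha a (-a) c (-c) q) *
     (aw_eigenvalue (a^2 * c^2) t n - aw_eigenvalue (a^2 * c^2) t k)"

text \<open>The recurrence that \<open>aw_orth_poly\<close> needs, with A = a^2 and C = c^2. In n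
  variables only p_0, ..., p_n occur, which leaves the coefficients up to index n - 1 to be
  constrained.\<close>

definition admissible_coeffs :: "complex \<Rightarrow> complex \<Rightarrow> complex \<Rightarrow> nat \<Rightarrow> (nat \<Rightarrow> complex) \<Rightarrow> bool" where
  "admissible_coeffs a c t n \<phi> \<longleftrightarrow> \<phi> 0 = 0 \<and>
     (\<forall>k. k + 2 \<le> n \<longrightarrow>
        \<phi> (k + 1) * (aw_eigenvalue (a^2 * c^2) t (k + 2) - aw_eigenvalue (a^2 * c^2) t k) =
        \<phi> k * ((1 + 1/t) * (t^3 - a^2*c^2*(t^k)^2) / (t * t^k)) +
        (t - 1/t)^2 * aw_eigenvalue (a^2 * c^2) t k - (t - 1/t) * (1 + a^2) * (1 + c^2))"

lemma alpha_nonzero: "a \<noteq> 0 \<Longrightarrow> c \<noteq> 0 \<Longrightarrow> q \<noteq> 0 \<Longrightarrow> alpha a (-a) c (-c) q \<noteq> 0"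
  by (simp add: alpha_def)

lemma koornwinder_op_column_laurent:
  assumes nz: "a \<noteq> 0" "c \<noteq> 0" "q \<noteq> 0" "t \<noteq> 0" and \<phi>: "admissible_coeffs a c t n \<phi>" and "k \<le> n"
  shows "koornwinder_op n a (-a) c (-c) q t (column_laurent \<phi> n k) =
    cst (column_eigenvalue a c q t n k) * emb (column_laurent \<phi> n k)"
proof -
  have inj: "inj_on (\<lambda>i. jouk (Xvar i)) {1..n}"
    by (auto simp: inj_on_def jouk_Xvar emb_inject Yvar_inject)
  have X: "Xvar j ^ 2 \<noteq> 1" "cst q * Xvar j ^ 2 \<noteq> 1" "Xvar j ^ 2 \<noteq> cst q" for j
    using Xvar_square_neq[of 1 j 1] Xvar_square_neq[of 1 j q] Xvar_square_neq[of q j 1] nz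
    by (simp_all add: cst_1)
  have rec: "cst (\<phi> (k + 1)) * (aw_eigenvalue (cst a ^ 2 * cst c ^ 2) (cst t) (k + 2) -
        aw_eigenvalue (cst a ^ 2 * cst c ^ 2) (cst t) k) =
      cst (\<phi> k) * ((1 + 1 / cst t) * (cst t ^ 3 - cst a ^ 2 * cst c ^ 2 * (cst t ^ k) ^ 2) / (cst t * cst t ^ k)) +
      (cst t - 1 / cst t)^2 * aw_eigenvalue (cst a ^ 2 * cst c ^ 2) (cst t) k -
      (cst t - 1 / cst t) * (1 + cst a ^ 2) * (1 + cst c ^ 2)" if "k + 2 \<le> n" for k
    using \<phi> that
    by (simp add: admissible_coeffs_def cst_aw_eigenvalue[symmetric] cst_mult[symmetric] cst_add[symmetric]
        cst_diff[symmetric] cst_divide[symmetric] cst_power[symmetric] cst_1[symmetric] cst_inject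
        del: power_mult_distrib)
  have "\<phi> 0 = 0" using \<phi> by (simp add: admissible_coeffs_def)
  then have "cst (\<phi> 0) = 0" by (simp add: cst_0)
  note main = column_poly_eigen[of "cst q" "cst t" "cst (alpha a (-a) c (-c) q)" Xvar n "\<lambda>k. cst (\<phi> k)"
      "cst a" "cst c" k, OF _ _ _ Xvar_nonzero X inj this rec \<open>k \<le> n\<close>]
  have "cst (inverse q) * Xvar i = Xvar i / cst q" for i
    by (simp add: inverse_eq_divide cst_divide cst_1)
  then show ?thesis
    using main nz alpha_nonzero[of a c q]
    by (simp add: koornwinder_op_kw_coeff emb_diff emb_scale_column_laurent emb_column_laurent
        column_eigenvalue_def cst_mult cst_divide cst_diff cst_1 cst_minus cst_aw_eigenvalue cst_power cst_eq_0_iff)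
qed

text \<open>Only the parts equal to 1 contribute. Because q \<alpha>^2 = a^2 c^2, the part with n -
  j = m contributes the constant (1 - q) / (q \<alpha>) times the increment of
  \<open>aw_eigenvalue\<close> at m, and m runs through k, ..., n - 1.\<close>

lemma koornwinder_eigenvalue_one_column:
  assumes nz: "a \<noteq> 0" "c \<noteq> 0" "q \<noteq> 0" "t \<noteq> 0" and "k \<le> n"
  shows "koornwinder_eigenvalue n a (-a) c (-c) q t (one_column (n - k)) = column_eigenvalue a c q t n k"
proof -
  define \<alpha> where "\<alpha> = alpha a (-a) c (-c) q"
  have "\<alpha>^2 = a * (-a) * c * (-c) / q" by (simp only: \<alpha>_def alpha_def power2_csqrt)
  then have \<alpha>: "\<alpha> \<noteq> 0" "q * \<alpha>^2 = a^2 * c^2"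
    using nz by (simp_all add: \<alpha>_def alpha_nonzero power2_eq_square)
  let ?g = "\<lambda>m. (1 - q) / (q * \<alpha>) * (1 / t^m - a^2 * c^2 * t^m)"
  have "koornwinder_eigenvalue n a (-a) c (-c) q t (one_column (n - k)) =
    (\<Sum>j=1..n. if j \<le> n - k then ?g (n - j) else 0)"
    unfolding koornwinder_eigenvalue_def \<alpha>_def[symmetric]
  proof (intro sum.cong refl)
    fix j assume j: "j \<in> {1..n}"
    define m where "m = n - j"
    have "int j - int n = - int m" using j by (simp add: m_def)
    then have tp: "t powi (int j - int n) = 1 / t^m" by (simp add: power_int_minus inverse_eq_divide)
    have "q * (\<alpha> * \<alpha>) = a^2 * c^2" using \<alpha>(2) by (simp add: power2_eq_square)
    then have "?g m = (1 - q) / (q * \<alpha>) * (1 / t^m - q * (\<alpha> * \<alpha>) * t^m)" by simp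
    also have "\<dots> = \<alpha> * t^m * q + inverse \<alpha> * (1 / t^m) * inverse q - \<alpha> * t^m - inverse \<alpha> * (1 / t^m)"
      using nz \<alpha>(1) by (simp add: field_simps)
    finally show "\<alpha> * t ^ (n - j) * q powi lkp (one_column (n - k)) j +
         inverse \<alpha> * t powi (int j - int n) * q powi - lkp (one_column (n - k)) j -
         \<alpha> * t ^ (n - j) - inverse \<alpha> * t powi (int j - int n) =
         (if j \<le> n - k then ?g (n - j) else 0)"
      using j unfolding tp m_def[symmetric] lookup_one_column by (simp add: power_int_minus)
  qed
  also have "\<dots> = (\<Sum>j\<in>{1..n-k}. ?g (n - j))"
    by (rule sum.mono_neutral_cong_right) auto
  also have "\<dots> = (\<Sum>m\<in>{k..<n}. ?g m)"
    by (rule sum.reindex_bij_witness[of _ "\<lambda>m. n - m" "\<lambda>j. n - j"]) (use \<open>k \<le> n\<close> in auto)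
  also have "\<dots> = (\<Sum>m<n. ?g m) - (\<Sum>m<k. ?g m)"
    using sum_diff_nat_ivl[of 0 k n ?g] \<open>k \<le> n\<close> by (simp add: lessThan_atLeast0)
  also have "\<dots> = column_eigenvalue a c q t n k"
    unfolding column_eigenvalue_def aw_eigenvalue_def \<alpha>_def[symmetric] sum_distrib_left[symmetric]
    by (simp only: right_diff_distrib[symmetric])
  finally show ?thesis .
qed

section \<open>The dominance order below a column\<close>

lemma is_partition_one_column: "s \<le> n \<Longrightarrow> is_partition n (one_column s)"
  by (auto simp: is_partition_def lookup_one_column in_keys_iff split: if_splits)

lemma keys_one_column: "Poly_Mapping.keys (one_column s) = {1..s}"
  by (auto simp: in_keys_iff lookup_one_column split: if_splits)

lemma one_column_inject: "one_column r = one_column s \<longleftrightarrow> r = s"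
  by (metis card_atLeastAtMost diff_Suc_1 keys_one_column)

text \<open>The dominance condition for i = 1 bounds the first part by 1, so a smaller partition is
  itself a column; the condition for i = n bounds its height.\<close>

lemma below_one_column:
  assumes "r \<le> n" "n \<ge> 1"
  shows "below n (one_column r) = one_column ` {..<r}"
proof (intro set_eqI iffI)
  fix m assume m: "m \<in> below n (one_column r)"
  then have nonneg: "\<And>i. i \<in> {1..n} \<Longrightarrow> 0 \<le> lkp m i"
    and mono: "\<And>i j. 1 \<le> i \<Longrightarrow> i \<le> j \<Longrightarrow> j \<le> n \<Longrightarrow> lkp m j \<le> lkp m i"
    and keys: "Poly_Mapping.keys m \<subseteq> {1..n}" and neq: "m \<noteq> one_column r"
    and dom: "\<And>i. i \<in> {1..n} \<Longrightarrow> (\<Sum>k=1..i. lkp m k) \<le> (\<Sum>k=1..i. lkp (one_column r) k)"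
    by (auto simp: below_def is_partition_def)
  have "lkp m 1 \<le> 1" using dom[of 1] assms(2) by (simp add: lookup_one_column split: if_splits)
  then have 01: "lkp m i = 0 \<or> lkp m i = 1" if "i \<in> {1..n}" for i
    using nonneg[OF that] mono[of 1 i] that by auto
  define s where "s = card (Poly_Mapping.keys m)"
  have down: "{1..Max (Poly_Mapping.keys m)} = Poly_Mapping.keys m" if "Poly_Mapping.keys m \<noteq> {}"
  proof (intro set_eqI iffI)
    fix i assume i: "i \<in> {1..Max (Poly_Mapping.keys m)}"
    have M: "Max (Poly_Mapping.keys m) \<in> Poly_Mapping.keys m" using that by simp
    then have n: "Max (Poly_Mapping.keys m) \<in> {1..n}" using keys by blast
    then have "lkp m (Max (Poly_Mapping.keys m)) = 1" "Max (Poly_Mapping.keys m) \<le> n"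
      using M 01[OF n] by (auto simp: in_keys_iff)
    then have "1 \<le> lkp m i" using mono[of i "Max (Poly_Mapping.keys m)"] i by simp
    then show "i \<in> Poly_Mapping.keys m" by (auto simp: in_keys_iff)
  qed (use keys in auto)
  have ks: "Poly_Mapping.keys m = {1..s}"
  proof (cases "Poly_Mapping.keys m = {}")
    case False
    then show ?thesis using down unfolding s_def by (metis card_atLeastAtMost diff_Suc_1)
  qed (simp add: s_def)
  have ms: "m = one_column s"
  proof (rule poly_mapping_eqI)
    fix i
    show "lkp m i = lkp (one_column s) i"
    proof (cases "i \<in> Poly_Mapping.keys m")
      case True
      then have "lkp m i = 1" using 01[of i] keys by (auto simp: in_keys_iff)
      then show ?thesis using True ks by (simp add: lookup_one_column)
    next
      case False
      then have "lkp m i = 0" by (simp add: in_keys_iff)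
      then show ?thesis using False ks by (simp add: lookup_one_column)
    qed
  qed
  have sn: "s \<le> n" using keys ks by (cases "s = 0") auto
  have tot: "(\<Sum>k=1..n. lkp (one_column u) k) = int u" if "u \<le> n" for u
  proof -
    have "(\<Sum>k=1..n. lkp (one_column u) k) = (\<Sum>k=1..u. 1)"
      by (rule sum.mono_neutral_cong_right) (use that in \<open>auto simp: lookup_one_column\<close>)
    then show ?thesis by simp
  qed
  have "s \<le> r" using dom[of n] assms tot[OF sn] tot[OF assms(1)] unfolding ms by simp
  moreover have "s \<noteq> r" using neq ms by blast
  ultimately show "m \<in> one_column ` {..<r}" using ms by auto
next
  fix m assume "m \<in> one_column ` {..<r}"
  then obtain s where s: "m = one_column s" "s < r" by auto
  then show "m \<in> below n (one_column r)"
    using assms is_partition_one_column[of s n]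
    by (auto simp: below_def one_column_inject intro!: sum_mono) (auto simp: lookup_one_column)
qed

section \<open>Unitriangularity and uniqueness of the one-column polynomials\<close>

lemma lookup_const_mult: "lkp (const_laurent z * p) \<mu> = z * lkp p \<mu>"
  by (simp add: const_laurent_def lookup_mult lookup_single when_def[symmetric] mult_when when_mult)

lemma lookup_orbit_sum_one_column:
  assumes "r \<le> n"
  shows "lkp (orbit_sum n (one_column r)) \<mu> = (if column_shape n r \<mu> then 1 else 0)"
  by (simp add: orbit_sum_one_column[OF assms] lookup_esym_Yvar)

lemma lookup_orbit_sum_combination:
  assumes "i \<le> n"
  shows "lkp (\<Sum>j\<le>n. const_laurent (v j) * orbit_sum n (one_column (n - j))) (one_column (n - i)) = v i"
proof -
  have "column_shape n (n - j) (one_column (n - i)) \<longleftrightarrow> j = i" if "j \<le> n" for j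
    using that assms by (auto simp: column_shape_def keys_one_column lookup_one_column)
  then have "lkp (\<Sum>j\<le>n. const_laurent (v j) * orbit_sum n (one_column (n - j))) (one_column (n - i)) =
      (\<Sum>j\<le>n. if j = i then v j else 0)"
    unfolding lookup_sum lookup_const_mult
    by (intro sum.cong refl) (simp add: lookup_orbit_sum_one_column)
  then show ?thesis using assms by simp
qed

lemma column_laurent_independent:
  assumes "(\<Sum>k\<le>n. const_laurent (x k) * column_laurent \<phi> n k) = 0" "j \<le> n"
  shows "x j = 0"
  using \<open>j \<le> n\<close>
proof (induction j rule: less_induct)
  case (less j)
  have "0 = lkp (\<Sum>k\<le>n. const_laurent (x k) * column_laurent \<phi> n k) (one_column (n - j))"
    using assms(1) by simp
  also have "\<dots> = (\<Sum>k\<le>n. x k * catalan \<phi> k j)"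
    using lookup_orbit_sum_combination[OF less.prems, of "\<lambda>j. catalan \<phi> _ j"]
    by (simp only: lookup_sum[of "\<lambda>k. const_laurent (x k) * _ k"] lookup_const_mult column_laurent_def)
  also have "\<dots> = (\<Sum>k\<le>n. if k = j then x j else 0)"
  proof (intro sum.cong refl)
    fix k assume "k \<in> {..n}"
    then show "x k * catalan \<phi> k j = (if k = j then x j else 0)"
      using less by (cases k j rule: linorder_cases) (auto simp: catalan_upper catalan_diag)
  qed
  finally show ?case using less.prems by simp
qed

text \<open>Elimination against a unitriangular matrix. The vanishing below s is carried along so
  that a difference of two polynomials with the same leading term involves only strictly smaller
  columns.\<close>

lemma column_laurent_span:
  assumes "\<And>j. j < s \<Longrightarrow> w j = 0"
  shows "\<exists>b. (\<forall>j<s. b j = 0) \<and>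
    (\<Sum>j\<le>n. const_laurent (w j) * orbit_sum n (one_column (n - j))) =
    (\<Sum>j\<le>n. const_laurent (b j) * column_laurent \<phi> n j)"
  using assms
proof (induction "Suc n - s" arbitrary: s w)
  case 0
  then have "(\<Sum>j\<le>n. const_laurent (w j) * orbit_sum n (one_column (n - j))) = 0"
    by (intro sum.neutral) (simp add: const_laurent_0)
  then show ?case by (intro exI[of _ "\<lambda>_. 0"]) (simp add: const_laurent_0)
next
  case (Suc d)
  then have s: "s \<le> n" "d = Suc n - Suc s" by auto
  define w' where "w' j = w j - w s * catalan \<phi> s j" for j
  have "w' j = 0" if "j < Suc s" for j
    using that Suc.prems by (cases "j = s") (auto simp: w'_def catalan_diag catalan_upper)
  from Suc.hyps(1)[OF s(2), of w', OF this] obtain b where b: "\<forall>j<Suc s. b j = 0"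
    "(\<Sum>j\<le>n. const_laurent (w' j) * orbit_sum n (one_column (n - j))) =
     (\<Sum>j\<le>n. const_laurent (b j) * column_laurent \<phi> n j)" by blast
  let ?M = "\<lambda>j. orbit_sum n (one_column (n - j))"
  have "(\<Sum>j\<le>n. const_laurent (w j) * ?M j) =
      (\<Sum>j\<le>n. const_laurent (w' j) * ?M j) + const_laurent (w s) * column_laurent \<phi> n s"
    unfolding column_laurent_def sum_distrib_left sum.distrib[symmetric]
    by (intro sum.cong refl)
       (simp add: w'_def const_laurent_diff const_laurent_mult algebra_simps)
  also have "const_laurent (w s) * column_laurent \<phi> n s =
      (\<Sum>j\<le>n. const_laurent (if j = s then w s else 0) * column_laurent \<phi> n j)"
    using s(1) by (simp add: if_distrib[of const_laurent] if_distribR const_laurent_0 sum.delta cong: if_cong)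
       (simp add: if_distrib[of "\<lambda>x. x * _"] sum.delta cong: if_cong)
  also have "(\<Sum>j\<le>n. const_laurent (w' j) * ?M j) + \<dots> =
      (\<Sum>j\<le>n. const_laurent (b j + (if j = s then w s else 0)) * column_laurent \<phi> n j)"
    unfolding b(2) sum.distrib[symmetric] by (intro sum.cong refl) (simp only: const_laurent_add distrib_right)
  finally show ?case
    using b(1) by (intro exI[of _ "\<lambda>j. b j + (if j = s then w s else 0)"]) auto
qed

lemma weyl_invariant_column_laurent: "weyl_invariant n (column_laurent \<phi> n k)"
  unfolding weyl_invariant_def column_laurent_def lookup_sum lookup_const_mult
  by (intro allI impI sum.cong refl) (simp add: lookup_orbit_sum_one_column weyl_conj_column_shape)

lemma laurent_in_column_laurent: "laurent_in n (column_laurent \<phi> n k)"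
  unfolding laurent_in_def
proof
  fix \<mu> assume "\<mu> \<in> Poly_Mapping.keys (column_laurent \<phi> n k)"
  then have "lkp (column_laurent \<phi> n k) \<mu> \<noteq> 0" by (simp add: in_keys_iff)
  then obtain j where "lkp (orbit_sum n (one_column (n - j))) \<mu> \<noteq> 0"
    unfolding column_laurent_def lookup_sum lookup_const_mult
    by (metis (no_types, lifting) mult_zero_right sum.neutral)
  then show "Poly_Mapping.keys \<mu> \<subseteq> {1..n}"
    by (auto simp: lookup_orbit_sum_one_column column_shape_def split: if_splits)
qed

lemma sum_below_one_column:
  assumes "k \<le> n" "n \<ge> 1"
  shows "orbit_sum n (one_column (n - k)) +
      (\<Sum>m\<in>below n (one_column (n - k)). const_laurent (u m) * orbit_sum n m) =
    (\<Sum>j\<le>n. const_laurent (if j < k then 0 else if j = k then 1 else u (one_column (n - j))) *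
       orbit_sum n (one_column (n - j)))" (is "_ = (\<Sum>j\<le>n. ?f j)")
proof -
  have "(\<Sum>m\<in>below n (one_column (n - k)). const_laurent (u m) * orbit_sum n m) =
      (\<Sum>s<n - k. const_laurent (u (one_column s)) * orbit_sum n (one_column s))"
    using assms by (subst below_one_column) (auto simp: sum.reindex inj_on_def one_column_inject)
  also have "\<dots> = (\<Sum>j\<in>{k<..n}. ?f j)"
    by (rule sum.reindex_bij_witness[of _ "\<lambda>j. n - j" "\<lambda>s. n - s"]) (use assms in auto)
  finally have "orbit_sum n (one_column (n - k)) +
      (\<Sum>m\<in>below n (one_column (n - k)). const_laurent (u m) * orbit_sum n m) =
      ?f k + (\<Sum>j\<in>{k<..n}. ?f j)" by (simp add: const_laurent_1)
  also have "\<dots> = (\<Sum>j\<in>{k..n}. ?f j)"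
    using assms(1) by (simp add: sum.head)
  also have "\<dots> = (\<Sum>j\<le>n. ?f j)"
    by (rule sum.mono_neutral_left) (auto simp: const_laurent_0)
  finally show ?thesis .
qed

lemma generic_nonzero:
  assumes "generic_params n a (-a) c (-c) q t"
  shows "a \<noteq> 0" "c \<noteq> 0" "q \<noteq> 0" "t \<noteq> 0"
  using assms by (auto simp: generic_params_def)

lemma generic_column_eigenvalue:
  assumes gen: "generic_params n a (-a) c (-c) q t" and "i < j" "j \<le> n"
  shows "column_eigenvalue a c q t n j \<noteq> column_eigenvalue a c q t n i"
proof -
  have "one_column (n - j) \<in> below n (one_column (n - i))"
    using assms(2,3) by (subst below_one_column) auto
  then have "koornwinder_eigenvalue n a (-a) c (-c) q t (one_column (n - j)) \<noteq>
      koornwinder_eigenvalue n a (-a) c (-c) q t (one_column (n - i))"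
    using gen is_partition_one_column[of "n - i" n] unfolding generic_params_def by simp
  then show ?thesis
    using koornwinder_eigenvalue_one_column[OF generic_nonzero(1-4)[OF gen]] assms(2,3) by simp
qed

lemma koornwinder_one_column:
  assumes gen: "generic_params n a (-a) c (-c) q t" and "n \<ge> 1" "k \<le> n"
    and \<phi>: "admissible_coeffs a c t n \<phi>"
  shows "koornwinder n a (-a) c (-c) q t (one_column (n - k)) = column_laurent \<phi> n k"
  unfolding koornwinder_def
proof (rule the_equality)
  note nz = generic_nonzero[OF gen]
  let ?l = "one_column (n - k)" and ?D = "koornwinder_op n a (-a) c (-c) q t"
  let ?e = "column_eigenvalue a c q t n"
  \<comment> \<open>The height of a column is recovered as the size of its support; height s has
    index n - s in the matrix.\<close>
  let ?u = "\<lambda>m. catalan \<phi> k (n - card (Poly_Mapping.keys m))"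
  have op: "?D (column_laurent \<phi> n j) = cst (?e j) * emb (column_laurent \<phi> n j)" if "j \<le> n" for j
    using koornwinder_op_column_laurent[OF nz(1-4) \<phi> that] .
  have ev: "koornwinder_eigenvalue n a (-a) c (-c) q t ?l = ?e k"
    using koornwinder_eigenvalue_one_column[OF nz(1-4) \<open>k \<le> n\<close>] .
  have "column_laurent \<phi> n k = orbit_sum n ?l + (\<Sum>m\<in>below n ?l. const_laurent (?u m) * orbit_sum n m)"
    unfolding sum_below_one_column[OF assms(3,2)] column_laurent_def
    by (intro sum.cong refl)
       (auto simp: catalan_upper catalan_diag keys_one_column linorder_not_less)
  then show "is_koornwinder n a (-a) c (-c) q t ?l (column_laurent \<phi> n k)"
    unfolding is_koornwinder_def ev op[OF \<open>k \<le> n\<close>]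
    by (intro conjI exI[of _ ?u] weyl_invariant_column_laurent laurent_in_column_laurent refl)
  fix p assume "is_koornwinder n a (-a) c (-c) q t ?l p"
  then obtain u where p: "p = orbit_sum n ?l + (\<Sum>m\<in>below n ?l. const_laurent (u m) * orbit_sum n m)"
    and Dp: "?D p = cst (?e k) * emb p" unfolding is_koornwinder_def ev by blast
  let ?M = "\<lambda>j. orbit_sum n (one_column (n - j))"
  define v where "v j = (if j < k then 0 else if j = k then 1 else u (one_column (n - j)))" for j
  define w where "w j = v j - catalan \<phi> k j" for j
  have r: "p - column_laurent \<phi> n k = (\<Sum>j\<le>n. const_laurent (w j) * ?M j)"
    unfolding p sum_below_one_column[OF assms(3,2)] column_laurent_def sum_subtractf[symmetric] v_def[symmetric]
    by (intro sum.cong refl) (simp add: w_def const_laurent_diff left_diff_distrib)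
  \<comment> \<open>Both polynomials have leading term of coefficient 1 at index k, so the
    difference starts at index k + 1.\<close>
  have "w j = 0" if "j < Suc k" for j
    using that by (cases "j = k") (auto simp: w_def v_def catalan_upper catalan_diag)
  from column_laurent_span[of "Suc k" w n \<phi>, OF this] obtain b where b: "\<forall>j<Suc k. b j = 0"
    and rb: "p - column_laurent \<phi> n k = (\<Sum>j\<le>n. const_laurent (b j) * column_laurent \<phi> n j)"
    unfolding r by blast
  have "?D p = ?D (p - column_laurent \<phi> n k) + ?D (column_laurent \<phi> n k)"
    by (simp flip: koornwinder_op_add)
  then have "?D (p - column_laurent \<phi> n k) = cst (?e k) * emb (p - column_laurent \<phi> n k)"
    unfolding Dp op[OF \<open>k \<le> n\<close>] emb_diff by (simp add: right_diff_distrib)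
  moreover have "?D (p - column_laurent \<phi> n k) = (\<Sum>j\<le>n. cst (b j * ?e j) * emb (column_laurent \<phi> n j))"
    unfolding rb koornwinder_op_sum koornwinder_op_const_mult[OF nz(3)]
    by (intro sum.cong refl) (simp add: op cst_mult mult.assoc)
  \<comment> \<open>The difference has eigenvalue \<open>?e k\<close>, yet it combines eigenvectors
    with j > k, whose eigenvalues are different by genericity.\<close>
  ultimately have "(\<Sum>j\<le>n. cst (b j * (?e j - ?e k)) * emb (column_laurent \<phi> n j)) = 0"
    unfolding rb emb_sum emb_mult cst_def[symmetric] sum_distrib_left
    by (simp add: right_diff_distrib cst_diff cst_mult left_diff_distrib sum_subtractf mult_ac)
  then have "(\<Sum>j\<le>n. const_laurent (b j * (?e j - ?e k)) * column_laurent \<phi> n j) = 0"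
    by (simp only: cst_def emb_mult[symmetric] emb_sum[symmetric] emb_0[symmetric] emb_inject)
  then have "b j * (?e j - ?e k) = 0" if "j \<le> n" for j
    using column_laurent_independent[where x = "\<lambda>j. b j * (?e j - ?e k)"] that by blast
  then have "b j = 0" if "j \<le> n" for j
    using generic_column_eigenvalue[OF gen, of k j] b that by (cases "j < Suc k") auto
  then have "p - column_laurent \<phi> n k = 0" unfolding rb
    by (intro sum.neutral) (simp add: const_laurent_0)
  then show "p = column_laurent \<phi> n k" by simp
qed


section \<open>The recurrence coefficients and their values\<close>

lemma eval_poly_simps:
  "eval_poly 0 a c t = 0" "eval_poly 1 a c t = 1"
  "eval_poly (p + p') a c t = eval_poly p a c t + eval_poly p' a c t"
  "eval_poly (p - p') a c t = eval_poly p a c t - eval_poly p' a c t"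
  "eval_poly (p * p') a c t = eval_poly p a c t * eval_poly p' a c t"
  by (simp_all add: eval_poly_def)

text \<open>Regularity and value in one relation: it passes through the field operations without
  descriptions, and determines \<open>eval_ratfun\<close> by uniqueness.\<close>

definition has_value :: "ratfun \<Rightarrow> complex \<Rightarrow> complex \<Rightarrow> complex \<Rightarrow> complex \<Rightarrow> bool" where
  "has_value r a c t v \<longleftrightarrow>
     (\<exists>N D. r = Fract N D \<and> eval_poly D a c t \<noteq> 0 \<and> v = eval_poly N a c t / eval_poly D a c t)"

lemma has_valueI: "eval_poly D a c t \<noteq> 0 \<Longrightarrow> has_value (Fract N D) a c t (eval_poly N a c t / eval_poly D a c t)"
  unfolding has_value_def by blast

lemma eval_poly_nonzero: "eval_poly D a c t \<noteq> 0 \<Longrightarrow> D \<noteq> 0"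
  by (auto simp: eval_poly_simps)

lemma has_value_unique:
  assumes "has_value r a c t v" "has_value r a c t v'"
  shows "v = v'"
proof -
  obtain N D N' D' where *: "Fract N D = Fract N' D'" "eval_poly D a c t \<noteq> 0" "eval_poly D' a c t \<noteq> 0"
    "v = eval_poly N a c t / eval_poly D a c t" "v' = eval_poly N' a c t / eval_poly D' a c t"
    using assms unfolding has_value_def by metis
  then have "N * D' = N' * D" by (simp add: eq_fract eval_poly_nonzero)
  then have "eval_poly N a c t * eval_poly D' a c t = eval_poly N' a c t * eval_poly D a c t"
    by (simp flip: eval_poly_simps)
  then show ?thesis using * by (simp add: frac_eq_eq)
qed

lemma eval_ratfun_eq: "has_value r a c t v \<Longrightarrow> eval_ratfun r a c t = v"
  using has_value_unique unfolding eval_ratfun_def has_value_def[symmetric] by blast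

lemma regular_at_has_value: "has_value r a c t v \<Longrightarrow> regular_at r a c t"
  unfolding has_value_def regular_at_def by blast

lemma has_value_0: "has_value 0 a c t 0" and has_value_1: "has_value 1 a c t 1"
  using has_valueI[of 1 a c t 0] has_valueI[of 1 a c t 1] by (simp_all add: eval_poly_simps fract_collapse)

lemma has_value_var: "has_value var_a a c t a" "has_value var_c a c t c" "has_value var_t a c t t"
  using has_valueI[of 1 a c t "[:[:[:0, 1:]:]:]"] has_valueI[of 1 a c t "[:[:0, 1:]:]"]
    has_valueI[of 1 a c t "[:0, 1:]"]
  by (simp_all add: eval_poly_simps var_a_def var_c_def var_t_def) (simp_all add: eval_poly_def)

lemma has_value_add:
  assumes "has_value r a c t v" "has_value r' a c t v'"
  shows "has_value (r + r') a c t (v + v')"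
proof -
  obtain N D N' D' where *: "r = Fract N D" "eval_poly D a c t \<noteq> 0" "v = eval_poly N a c t / eval_poly D a c t"
    "r' = Fract N' D'" "eval_poly D' a c t \<noteq> 0" "v' = eval_poly N' a c t / eval_poly D' a c t"
    using assms unfolding has_value_def by metis
  then show ?thesis
    using has_valueI[of "D * D'" a c t "N * D' + N' * D"] by (simp add: eval_poly_simps eval_poly_nonzero add_frac_eq)
qed

lemma has_value_diff:
  assumes "has_value r a c t v" "has_value r' a c t v'"
  shows "has_value (r - r') a c t (v - v')"
proof -
  obtain N D N' D' where *: "r = Fract N D" "eval_poly D a c t \<noteq> 0" "v = eval_poly N a c t / eval_poly D a c t"
    "r' = Fract N' D'" "eval_poly D' a c t \<noteq> 0" "v' = eval_poly N' a c t / eval_poly D' a c t"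
    using assms unfolding has_value_def by metis
  then show ?thesis
    using has_valueI[of "D * D'" a c t "N * D' - N' * D"] by (simp add: eval_poly_simps eval_poly_nonzero diff_frac_eq)
qed

lemma has_value_mult:
  assumes "has_value r a c t v" "has_value r' a c t v'"
  shows "has_value (r * r') a c t (v * v')"
proof -
  obtain N D N' D' where *: "r = Fract N D" "eval_poly D a c t \<noteq> 0" "v = eval_poly N a c t / eval_poly D a c t"
    "r' = Fract N' D'" "eval_poly D' a c t \<noteq> 0" "v' = eval_poly N' a c t / eval_poly D' a c t"
    using assms unfolding has_value_def by metis
  then show ?thesis
    using has_valueI[of "D * D'" a c t "N * N'"] by (simp add: eval_poly_simps eval_poly_nonzero)
qed

lemma has_value_divide:
  assumes "has_value r a c t v" "has_value r' a c t v'" "v' \<noteq> 0"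
  shows "has_value (r / r') a c t (v / v')"
proof -
  obtain N D N' D' where *: "r = Fract N D" "eval_poly D a c t \<noteq> 0" "v = eval_poly N a c t / eval_poly D a c t"
    "r' = Fract N' D'" "eval_poly D' a c t \<noteq> 0" "v' = eval_poly N' a c t / eval_poly D' a c t"
    using assms unfolding has_value_def by metis
  then show ?thesis using assms(3)
    using has_valueI[of "D * N'" a c t "N * D'"] by (simp add: eval_poly_simps eval_poly_nonzero)
qed

lemma has_value_power: "has_value r a c t v \<Longrightarrow> has_value (r ^ k) a c t (v ^ k)"
  by (induction k) (auto intro: has_value_1 has_value_mult)

lemmas has_value_intros = has_value_1 has_value_var has_value_add has_value_diff has_value_mult
  has_value_divide has_value_power

section \<open>The coefficients f(t^k) and their recurrence\<close>

definition rec_coeff :: "'a::field \<Rightarrow> 'a \<Rightarrow> 'a \<Rightarrow> 'a \<Rightarrow> 'a" where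
  "rec_coeff a c t s = (1 - 1 / s) * (1 - t ^ 2 / (s * a ^ 2 * c ^ 2)) *
         (1 + t / (s * a ^ 2)) * (1 + t / (s * c ^ 2)) /
         ((1 - t / (s ^ 2 * a ^ 2 * c ^ 2)) * (1 - t ^ 3 / (s ^ 2 * a ^ 2 * c ^ 2)))"

lemma f_coeff_eq: "f_coeff s = rec_coeff var_a var_c var_t s"
  by (simp add: f_coeff_def rec_coeff_def)

text \<open>At \<open>s = t\<close> the factors \<open>1 - t / (a\<^sup>2 c\<^sup>2)\<close> cancel; genericity does not exclude
  that they vanish.\<close>

definition rec_coeff_t :: "'a::field \<Rightarrow> 'a \<Rightarrow> 'a \<Rightarrow> 'a" where
  "rec_coeff_t a c t = (1 - 1 / t) * (1 + 1 / a ^ 2) * (1 + 1 / c ^ 2) / (1 - 1 / (t * a ^ 2 * c ^ 2))"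

definition recurrence_coeff :: "'a::field \<Rightarrow> 'a \<Rightarrow> 'a \<Rightarrow> nat \<Rightarrow> 'a" where
  "recurrence_coeff a c t k = (if k = 0 then 0 else if k = 1 then rec_coeff_t a c t else rec_coeff a c t (t ^ k))"

lemma rec_coeff_at_t:
  fixes a c t :: "'a::field"
  assumes "a \<noteq> 0" "c \<noteq> 0" "t \<noteq> 0" "t \<noteq> a^2 * c^2"
  shows "rec_coeff a c t t = rec_coeff_t a c t"
proof -
  define w where "w = 1 - t / (a^2 * c^2)"
  have "w \<noteq> 0" using assms by (simp add: w_def)
  have "t / (t * a^2) = 1 / a^2" "t / (t * c^2) = 1 / c^2" "t ^ 2 / (t * a ^ 2 * c ^ 2) = t / (a^2 * c^2)"
    "t / (t ^ 2 * a ^ 2 * c ^ 2) = 1 / (t * a^2 * c^2)" "t ^ 3 / (t ^ 2 * a ^ 2 * c ^ 2) = t / (a^2 * c^2)"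
    using assms by (simp_all add: power2_eq_square power3_eq_cube)
  then show ?thesis using \<open>w \<noteq> 0\<close>
    unfolding rec_coeff_def rec_coeff_t_def w_def[symmetric] by (simp add: w_def[symmetric])
qed

text \<open>At s = t^k the denominators of f(s) vanish when a^2 c^2 t^(2k-1) = 1 or a^2 c^2 t^(2k-3)
  = 1. The second equation is the first one for k - 1; for k = 1 it concerns the factor cancelled in
  \<open>rec_coeff_t\<close>.\<close>

definition generic_products :: "'a::field \<Rightarrow> 'a \<Rightarrow> 'a \<Rightarrow> nat \<Rightarrow> bool" where
  "generic_products a c t n \<longleftrightarrow> (\<forall>k. 1 \<le> k \<longrightarrow> k < n \<longrightarrow> a^2 * c^2 * t^(2 * k - 1) \<noteq> 1)"

lemma aw_eigenvalue_closed:
  fixes t P :: "'a::field"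
  assumes "t \<noteq> 0"
  shows "(1 - t) * aw_eigenvalue P t k = t / t^k - t - P + P * t^k"
proof (induction k)
  case (Suc k)
  have "(1 - t) * aw_eigenvalue P t (Suc k) = (t / t^k - t - P + P * t^k) + (1 - t) * (1 / t^k - P * t^k)"
    using Suc by (simp add: aw_eigenvalue_def distrib_left)
  also have "\<dots> = t / t^Suc k - t - P + P * t^Suc k"
    using assms by (simp add: field_simps)
  finally show ?case .
qed (simp add: aw_eigenvalue_def)

text \<open>The recurrence of \<open>admissible_coeffs\<close> for k \<ge> 1, with s = t^k, after
  the eigenvalue factors have cancelled a denominator of each coefficient f(t^(k+1)) and
  f(t^k).\<close>

lemma rec_coeff_telescope:
  fixes A C s t :: "'a::field"
  assumes nz: "A \<noteq> 0" "C \<noteq> 0" "s \<noteq> 0" "t \<noteq> 0"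
    and w: "s^2 * (A*C) - t \<noteq> 0"
    and L: "(1 - t) * L = t / s - t - A*C + A*C*s"
  shows "- ((1 + 1/t) * (t*s - 1) * (s*(A*C) - t) * (s*A + 1) * (s*C + 1) / (s * (s^2*(A*C) - t))) =
    - ((1 + 1/t) * (s - 1) * (s*(A*C) - t^2) * (s*A + t) * (s*C + t) / (t * s * (s^2*(A*C) - t))) +
    (t - 1/t)^2 * L - (t - 1/t) * (1 + A) * (1 + C)"
proof -
  \<comment> \<open>The square contains (1 - t)^2, so one factor 1 - t can be spent on the closed
    form of (1 - t) L, without dividing by 1 - t.\<close>
  have "(t - 1/t)^2 * L = (1 - t) * (1 + t)^2 / t^2 * ((1 - t) * L)"
    using nz by (simp add: field_simps power2_eq_square)
  also have "\<dots> = (1 - t) * (1 + t)^2 / t^2 * (t / s - t - A*C + A*C*s)" unfolding L ..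
  finally show ?thesis using nz w by (simp add: divide_simps) algebra
qed

lemma rec_coeff_alt:
  fixes a c s t :: "'a::field"
  assumes "a \<noteq> 0" "c \<noteq> 0" "s \<noteq> 0"
  shows "rec_coeff a c t s = (s - 1) * (s*(a^2*c^2) - t^2) * (s*a^2 + t) * (s*c^2 + t) /
     ((s^2*(a^2*c^2) - t) * (s^2*(a^2*c^2) - t^3))"
proof -
  define A C where "A = a^2" and "C = c^2"
  have nz: "A \<noteq> 0" "C \<noteq> 0" using assms by (simp_all add: A_def C_def)
  have 1: "1 - 1/s = (s - 1)/s" "1 - t^2/(s*A*C) = (s*(A*C) - t^2)/(s*(A*C))" "1 + t/(s*A) = (s*A + t)/(s*A)"
    "1 + t/(s*C) = (s*C + t)/(s*C)" "1 - t/(s^2*A*C) = (s^2*(A*C) - t)/(s^2*(A*C))"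
    "1 - t^3/(s^2*A*C) = (s^2*(A*C) - t^3)/(s^2*(A*C))"
    using nz assms by (simp_all add: field_simps)
  have "X1/s * (X2/(s*(A*C))) * (X3/(s*A)) * (X4/(s*C)) / (Y1/(s^2*(A*C)) * (Y2/(s^2*(A*C)))) =
    X1 * X2 * X3 * X4 / (Y1 * Y2)" for X1 X2 X3 X4 Y1 Y2
    using nz assms by (simp add: divide_simps power2_eq_square)
  then show ?thesis unfolding rec_coeff_def A_def[symmetric] C_def[symmetric] 1 .
qed

lemma rec_coeff_t_alt:
  fixes a c t :: "'a::field"
  assumes "a \<noteq> 0" "c \<noteq> 0" "t \<noteq> 0"
  shows "rec_coeff_t a c t = (t - 1) * (a^2 + 1) * (c^2 + 1) / (t*(a^2*c^2) - 1)"
proof -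
  define A C where "A = a^2" and "C = c^2"
  have nz: "A \<noteq> 0" "C \<noteq> 0" using assms by (simp_all add: A_def C_def)
  have 1: "1 - 1/t = (t - 1)/t" "1 + 1/A = (A + 1)/A" "1 + 1/C = (C + 1)/C"
    "1 - 1/(t*A*C) = (t*(A*C) - 1)/(t*(A*C))"
    using nz assms by (simp_all add: field_simps)
  have "X1/t * (X3/A) * (X4/C) / (Y1/(t*(A*C))) = X1 * X3 * X4 / Y1" for X1 X3 X4 Y1
    using nz assms by (simp add: divide_simps)
  then show ?thesis unfolding rec_coeff_t_def A_def[symmetric] C_def[symmetric] 1 .
qed

lemma generic_products_neq:
  fixes a c t :: "'a::field"
  assumes t: "t \<noteq> 0" and gen: "generic_products a c t n"
  shows "1 \<le> k \<Longrightarrow> k < n \<Longrightarrow> (t^k)^2 * (a^2 * c^2) - t \<noteq> 0"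
    and "2 \<le> k \<Longrightarrow> k \<le> n \<Longrightarrow> (t^k)^2 * (a^2 * c^2) - t^3 \<noteq> 0"
proof -
  define P where "P = a^2 * c^2"
  show "(t^k)^2 * (a^2 * c^2) - t \<noteq> 0" if k: "1 \<le> k" "k < n"
  proof
    have "2 * k = Suc (2 * k - 1)" using k by simp
    then have "(t^k)^2 = t * t^(2*k - 1)"
      unfolding power_mult[symmetric] mult.commute[of k] by (metis power_Suc)
    moreover assume "(t^k)^2 * (a^2 * c^2) - t = 0"
    ultimately have "t * (P * t^(2*k - 1)) = t * 1" by (simp add: P_def mult_ac)
    then have "P * t^(2*k - 1) = 1" using t by (simp only: mult_cancel_left) blast
    then show False using gen[unfolded generic_products_def, rule_format, OF k] by (simp add: P_def)
  qed
  show "(t^k)^2 * (a^2 * c^2) - t^3 \<noteq> 0" if k: "2 \<le> k" "k \<le> n"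
  proof
    have "2 * k = 3 + (2 * (k - 1) - 1)" using k by simp
    then have "(t^k)^2 = t^3 * t^(2*(k - 1) - 1)"
      unfolding power_mult[symmetric] mult.commute[of k] by (simp only: power_add)
    moreover assume "(t^k)^2 * (a^2 * c^2) - t^3 = 0"
    ultimately have "t^3 * (P * t^(2*(k - 1) - 1)) = t^3 * 1" by (simp add: P_def mult_ac)
    then have "P * t^(2*(k - 1) - 1) = 1" using t by (simp only: mult_cancel_left) simp
    moreover have "1 \<le> k - 1" "k - 1 < n" using k by auto
    ultimately show False using gen[unfolded generic_products_def, rule_format, of "k - 1"]
      by (simp only: P_def)
  qed
qed

lemma admissible_recurrence_coeff:
  assumes nz: "a \<noteq> 0" "c \<noteq> 0" "t \<noteq> 0" and gen: "generic_products a c t n"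
  shows "admissible_coeffs a c t n (recurrence_coeff a c t)"
  unfolding admissible_coeffs_def
proof (intro conjI allI impI)
  show "recurrence_coeff a c t 0 = 0" by (simp add: recurrence_coeff_def)
  fix k assume k: "k + 2 \<le> n"
  define s where "s = t^k"
  define A C where "A = a^2" and "C = c^2"
  define l where "l = aw_eigenvalue (A * C) t"
  have nz': "A \<noteq> 0" "C \<noteq> 0" "s \<noteq> 0" using nz by (simp_all add: A_def C_def s_def)
  have wt: "t*s^2*(A*C) - 1 \<noteq> 0"
    using gen[unfolded generic_products_def, rule_format, of "k + 1"] k
    by (simp add: A_def C_def s_def power_mult[symmetric] mult_ac)
  have w1: "s^2*(A*C) - t \<noteq> 0" if "k \<ge> 1"
    using generic_products_neq(1)[OF nz(3) gen that] k by (simp add: s_def A_def C_def)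
  have w3: "s^2*(A*C) - t^3 \<noteq> 0" if "k \<ge> 2"
    using generic_products_neq(2)[OF nz(3) gen that] k by (simp add: s_def A_def C_def)
  \<comment> \<open>Up to a power of t, the factor t s^2 A C - 1 is also a denominator of
    f(t^(k+1)), so it disappears from the product on the left of the recurrence.\<close>
  have ld: "l (k + 2) - l k = - ((1 + 1/t) * (t*s^2*(A*C) - 1) / s)"
    using nz by (simp add: l_def aw_eigenvalue_def s_def field_simps power2_eq_square)
  have L: "(1 - t) * l k = t / s - t - A*C + A*C*s"
    using aw_eigenvalue_closed[OF nz(3), of "A*C" k] by (simp add: l_def s_def)
  have "recurrence_coeff a c t (k + 1) * (l (k + 2) - l k) =
    recurrence_coeff a c t k * ((1 + 1/t) * (t^3 - A*C*s^2) / (t * s)) +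
    (t - 1/t)^2 * l k - (t - 1/t) * (1 + A) * (1 + C)"
  proof (cases "k = 0")
    case True
    then have s1: "s = 1" "l k = 0" by (simp_all add: s_def l_def aw_eigenvalue_def)
    have "recurrence_coeff a c t 1 * (l (k + 2) - l k) = - ((t - 1) * (A + 1) * (C + 1) * (1 + 1/t))"
      using wt unfolding ld unfolding s1(1) recurrence_coeff_def
      by (simp add: rec_coeff_t_alt[OF nz] A_def[symmetric] C_def[symmetric])
    also have "\<dots> = - ((t - 1/t) * (1 + A) * (1 + C))"
      using nz by (simp add: field_simps)
    finally show ?thesis using True by (simp add: recurrence_coeff_def s1(2)[unfolded True])
  next
    case False
    have next_coeff: "recurrence_coeff a c t (k + 1) = (t*s - 1) * (s*(A*C) - t) * (s*A + 1) * (s*C + 1) /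
        ((t*s^2*(A*C) - 1) * (s^2*(A*C) - t))"
    proof -
      have "recurrence_coeff a c t (k + 1) = rec_coeff a c t (t * s)" using False by (simp add: recurrence_coeff_def s_def)
      also have "\<dots> = (t*s - 1) * (t*s*(A*C) - t^2) * (t*s*A + t) * (t*s*C + t) /
         (((t*s)^2*(A*C) - t) * ((t*s)^2*(A*C) - t^3))"
        using rec_coeff_alt[of a c "t*s" t] nz nz' by (simp add: A_def C_def)
      also have "t*s*(A*C) - t^2 = t * (s*(A*C) - t)" by algebra
      also have "t*s*A + t = t * (s*A + 1)" by algebra
      also have "t*s*C + t = t * (s*C + 1)" by algebra
      also have "(t*s)^2*(A*C) - t = t * (t*s^2*(A*C) - 1)" by algebra
      also have "(t*s)^2*(A*C) - t^3 = t^2 * (s^2*(A*C) - t)" by algebra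
      finally show ?thesis using nz(3) by (simp add: divide_simps power2_eq_square)
    qed
    \<comment> \<open>For k \<ge> 2 the factor t^3 - A C s^2 cancels the second denominator of
      f(t^k). For k = 1 that denominator is t^2 (A C - t) and may be 0; with the reduced coefficient
      both sides keep the factor A C - t and agree anyway.\<close>
    have this_coeff: "recurrence_coeff a c t k * ((1 + 1/t) * (t^3 - A*C*s^2) / (t * s)) =
       - ((1 + 1/t) * (s - 1) * (s*(A*C) - t^2) * (s*A + t) * (s*C + t) / (t * s * (s^2*(A*C) - t)))"
    proof (cases "k = 1")
      case True
      then have s: "s = t" by (simp add: s_def)
      have "recurrence_coeff a c t k = (t - 1) * (A + 1) * (C + 1) / (t*(A*C) - 1)"
        using True rec_coeff_t_alt[OF nz] by (simp add: recurrence_coeff_def A_def C_def)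
      moreover have "t^2*(A*C) - t = t * (t*(A*C) - 1)" by algebra
      moreover have "t*(A*C) - 1 \<noteq> 0" using w1 True s nz(3) calculation(2) by auto
      ultimately show ?thesis unfolding s using nz(3) by (simp add: divide_simps) algebra
    next
      case False
      then have k2: "k \<ge> 2" using \<open>k \<noteq> 0\<close> by simp
      have rk: "recurrence_coeff a c t k = (s - 1) * (s*(A*C) - t^2) * (s*A + t) * (s*C + t) /
          ((s^2*(A*C) - t) * (s^2*(A*C) - t^3))"
        using k2 rec_coeff_alt[of a c s t] nz nz' by (simp add: recurrence_coeff_def s_def A_def C_def)
      have cancel: "X1 * X2 * X3 * X4 / (w1 * w3) * (d * u / (t * s)) = - (d * X1 * X2 * X3 * X4 / (t * s * w1))"
        if "w1 \<noteq> 0" "w3 \<noteq> 0" "u = - w3" for X1 X2 X3 X4 w1 w3 d u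
        using that nz nz' by (simp add: divide_simps)
      show ?thesis unfolding rk by (rule cancel) (use w1 w3 k2 in \<open>auto simp: mult.commute\<close>)
    qed
    have cancel: "X1 * X2 * X3 * X4 / (wt * w1) * - (d * wt / s) = - (d * X1 * X2 * X3 * X4 / (s * w1))"
      if "w1 \<noteq> 0" "wt \<noteq> 0" for X1 X2 X3 X4 w1 wt d
      using that nz nz' by (simp add: divide_simps)
    have "recurrence_coeff a c t (k + 1) * (l (k + 2) - l k) =
      - ((1 + 1/t) * (t*s - 1) * (s*(A*C) - t) * (s*A + 1) * (s*C + 1) / (s * (s^2*(A*C) - t)))"
      unfolding ld next_coeff by (rule cancel) (use w1 wt False in auto)
    then show ?thesis
      unfolding this_coeff by (rule trans) (rule rec_coeff_telescope[OF nz'(1,2,3) nz(3) _ L], use w1 False in auto)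
  qed
  then show "recurrence_coeff a c t (k + 1) * (aw_eigenvalue (a^2 * c^2) t (k + 2) - aw_eigenvalue (a^2 * c^2) t k) =
        recurrence_coeff a c t k * ((1 + 1/t) * (t^3 - a^2*c^2*(t^k)^2) / (t * t^k)) +
        (t - 1/t)^2 * aw_eigenvalue (a^2 * c^2) t k - (t - 1/t) * (1 + a^2) * (1 + c^2)"
    by (simp only: l_def A_def C_def s_def)
qed


section \<open>Stability and uniqueness\<close>

text \<open>If a^2 c^2 t^(2k-1) = 1, the increments of \<open>aw_eigenvalue\<close> at k - 1 and k
  are opposite, so the columns with indices k - 1 and k + 1, which are comparable, would share their
  eigenvalue.\<close>

lemma generic_imp_generic_products:
  assumes gen: "generic_params n a (-a) c (-c) q t"
  shows "generic_products a c t n"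
  unfolding generic_products_def
proof (intro allI impI notI)
  fix k assume k: "1 \<le> k" "k < n" and eq: "a^2 * c^2 * t^(2*k - 1) = 1"
  obtain m where m: "k = Suc m" using k(1) by (cases k) auto
  have t: "t \<noteq> 0" using generic_nonzero[OF gen] by simp
  have "2 * k - 1 = m + Suc m" using m by simp
  then have "(a^2 * c^2 * t^Suc m) * t^m = 1" using eq by (simp only: power_add mult.assoc mult.commute)
  then have 1: "1 / t^m = a^2 * c^2 * t^Suc m" using t by (simp add: divide_eq_eq)
  then have "1 / t^Suc m = a^2 * c^2 * t^m" using t by (simp add: field_simps)
  with 1 have "aw_eigenvalue (a^2 * c^2) t (Suc k) = aw_eigenvalue (a^2 * c^2) t m"
    by (simp add: aw_eigenvalue_def m)
  moreover have "column_eigenvalue a c q t n (Suc k) \<noteq> column_eigenvalue a c q t n m"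
    using generic_column_eigenvalue[OF gen, of m "Suc k"] k m by simp
  ultimately show False by (simp add: column_eigenvalue_def)
qed

lemma has_value_rec_coeff:
  assumes s: "has_value s a c t v" "v \<noteq> 0" and nz: "a \<noteq> 0" "c \<noteq> 0"
    and den: "v^2 * (a^2 * c^2) - t \<noteq> 0" "v^2 * (a^2 * c^2) - t^3 \<noteq> 0"
  shows "has_value (rec_coeff var_a var_c var_t s) a c t (rec_coeff a c t v)"
proof -
  have "1 - t / (v^2 * a^2 * c^2) \<noteq> 0" "1 - t^3 / (v^2 * a^2 * c^2) \<noteq> 0"
    using den s(2) nz by (simp_all add: field_simps)
  then show ?thesis unfolding rec_coeff_def using s nz
    by (intro has_value_intros) auto
qed

lemma has_value_rec_coeff_t:
  assumes nz: "a \<noteq> 0" "c \<noteq> 0" "t \<noteq> 0" and den: "a^2 * c^2 * t \<noteq> 1"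
  shows "has_value (rec_coeff_t var_a var_c var_t) a c t (rec_coeff_t a c t)"
proof -
  have "1 - 1 / (t * a^2 * c^2) \<noteq> 0" using den nz by (simp add: field_simps)
  then show ?thesis unfolding rec_coeff_t_def using nz
    by (intro has_value_intros) auto
qed

lemma has_value_neq: "has_value r a c t v \<Longrightarrow> has_value r' a c t v' \<Longrightarrow> v \<noteq> v' \<Longrightarrow> r \<noteq> r'"
  using has_value_unique by blast

lemma f_coeff_var_t: "f_coeff var_t = rec_coeff_t var_a var_c var_t"
  unfolding f_coeff_eq
proof (rule rec_coeff_at_t)
  show "var_a \<noteq> 0" "var_c \<noteq> 0" "var_t \<noteq> 0"
    using has_value_neq[OF has_value_var(1)[of 1 1 1] has_value_0]
      has_value_neq[OF has_value_var(2)[of 1 1 1] has_value_0]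
      has_value_neq[OF has_value_var(3)[of 1 1 1] has_value_0] by auto
  \<comment> \<open>The point a = c = 1, t = 2 separates the rational functions t and a^2
    c^2.\<close>
  have "has_value (var_a^2 * var_c^2) 1 1 2 (1^2 * 1^2)" by (intro has_value_intros)
  then show "var_t \<noteq> var_a^2 * var_c^2"
    using has_value_neq[OF has_value_var(3)[of 1 1 2]] by auto
qed

lemma has_value_f_coeff:
  assumes nz: "a \<noteq> 0" "c \<noteq> 0" "t \<noteq> 0" and gen: "generic_products a c t n" and k: "1 \<le> k" "k < n"
  shows "has_value (f_coeff (var_t^k)) a c t (recurrence_coeff a c t k)"
proof (cases "k = 1")
  case True
  have "a^2 * c^2 * t \<noteq> 1"
    using gen[unfolded generic_products_def, rule_format, of 1] k True by simp
  then show ?thesis using has_value_rec_coeff_t[OF nz] True by (simp add: f_coeff_var_t recurrence_coeff_def)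
next
  case False
  then have "has_value (f_coeff (var_t^k)) a c t (rec_coeff a c t (t^k))"
    unfolding f_coeff_eq using generic_products_neq[OF nz(3) gen, of k] k nz
    by (intro has_value_rec_coeff has_value_intros) auto
  then show ?thesis using False k by (simp add: recurrence_coeff_def)
qed

section \<open>The transition matrix and its characterization by the recursion\<close>

abbreviation transition :: "nat \<Rightarrow> nat \<Rightarrow> ratfun" where
  "transition \<equiv> catalan (\<lambda>k. f_coeff (var_t ^ k))"

lemma has_value_transition:
  assumes nz: "a \<noteq> 0" "c \<noteq> 0" "t \<noteq> 0" and gen: "generic_products a c t n" and "j \<le> n"
  shows "has_value (transition i j) a c t (catalan (recurrence_coeff a c t) i j)"
  using \<open>j \<le> n\<close>
proof (induction j arbitrary: i)
  case 0
  then show ?case using has_value_0 has_value_1 by simp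
next
  case (Suc j)
  have "has_value (f_coeff (var_t^k) * transition k j) a c t (recurrence_coeff a c t k * catalan (recurrence_coeff a c t) k j)"
    if "1 \<le> k" for k
  \<comment> \<open>For j < k the entry is 0 and f(t^k) may be singular at the point, but the
    product is the rational function 0. Otherwise k \<le> j < n, where f(t^k) has a value.\<close>
  proof (cases "j < k")
    case True
    then show ?thesis using has_value_0 by (simp add: catalan_upper)
  next
    case False
    then show ?thesis using Suc that by (intro has_value_mult has_value_f_coeff[OF nz gen]) auto
  qed
  note step = this and IH = Suc.IH and prems = Suc.prems
  show ?case
  proof (cases i)
    case 0
    then show ?thesis using step[of 1] by simp
  next
    case (Suc m)
    then show ?thesis
      using has_value_add[OF IH step[of "Suc (Suc m)"]] prems by (simp del: power_Suc)
  qed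
qed

text \<open>Off the diagonal each relation computes an entry of a column from the preceding column;
  the diagonal is constantly 1, and the shape supplies the remaining zeros.\<close>

lemma recursion_imp_transition:
  assumes "even_upper_triangular C" "recursion_relations C"
  shows "C i j = transition i j"
proof (induction j arbitrary: i)
  case 0
  then show ?case using assms by (cases "i = 0") (auto simp: even_upper_triangular_def recursion_relations_def)
next
  case (Suc j)
  have diag: "C m m = 1" for m
    using assms(2) by (induction m) (auto simp: recursion_relations_def, metis One_nat_def diff_Suc_1 le_add1 plus_1_eq_Suc)
  consider "Suc j < i" | "odd (i + Suc j)" | "i = Suc j" | "i < Suc j" "even (i + Suc j)" by linarith
  then show ?case
  proof cases
    case 1
    then show ?thesis using assms(1) by (simp add: even_upper_triangular_def catalan_upper del: catalan.simps)
  next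
    case 2
    then show ?thesis using assms(1)
      by (simp add: even_upper_triangular_def catalan_odd del: catalan.simps even_add odd_add)
  next
    case 3
    then show ?thesis using diag catalan_diag by metis
  next
    case 4
    show ?thesis
    proof (cases i)
      case 0
      then have "2 \<le> Suc j" "even (Suc j)" using 4 by (auto elim: oddE)
      then have "f_coeff var_t * C 1 (Suc j - 1) = C 0 (Suc j)"
        using assms(2) unfolding recursion_relations_def by blast
      then show ?thesis using 0 Suc by simp
    next
      case (Suc i')
      have "C (i - 1) (Suc j - 1) + f_coeff (var_t ^ (i + 1)) * C (i + 1) (Suc j - 1) = C i (Suc j)"
        using assms(2) 4 Suc unfolding recursion_relations_def by blast
      then show ?thesis using Suc Suc.IH by simp
    qed
  qed
qed

lemma even_upper_triangular_transition: "even_upper_triangular transition"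
  by (simp add: even_upper_triangular_def catalan_upper catalan_odd del: even_add odd_add)

lemma recursion_transition: "recursion_relations transition"
  unfolding recursion_relations_def
proof (intro conjI allI impI)
  show "transition 0 0 = 1" by simp
  show "transition (i - 1) (i - 1) = transition i i" for i by (simp only: catalan_diag)
  show "f_coeff var_t * transition 1 (j - 1) = transition 0 j" if "2 \<le> j" for j
    using that by (cases j) auto
  show "transition (i - 1) (j - 1) + f_coeff (var_t ^ (i + 1)) * transition (i + 1) (j - 1) = transition i j"
    if "0 < i" "i < j" for i j using that by (cases i; cases j) auto
qed

lemma P_vec_eq:
  assumes gen: "generic_params n a (-a) c (-c) q t" and "n \<ge> 1"
  shows "P_vec n a c q t i = (\<Sum>j\<le>n. const_laurent (catalan (recurrence_coeff a c t) i j) * m_vec n j)"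
proof (cases "i \<le> n")
  case True
  have "P_vec n a c q t i = column_laurent (recurrence_coeff a c t) n i"
    using koornwinder_one_column[OF gen \<open>n \<ge> 1\<close> True admissible_recurrence_coeff]
      generic_nonzero[OF gen] generic_imp_generic_products[OF gen] True by (simp add: P_vec_def)
  then show ?thesis by (simp add: column_laurent_def m_vec_def)
next
  case False
  then have "catalan (recurrence_coeff a c t) i j = 0" if "j \<le> n" for j using that by (simp add: catalan_upper)
  then show ?thesis using False by (simp add: P_vec_def const_laurent_0)
qed

lemma stability_transition: "stability transition"
  unfolding stability_def
proof (intro allI impI)
  fix n a c q t i assume n: "n \<ge> 1" and gen: "generic_params n a (-a) c (-c) q t"
  note nz = generic_nonzero[OF gen]
  have "eval_ratfun (transition i j) a c t = catalan (recurrence_coeff a c t) i j" if "j \<le> n" for j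
    using has_value_transition[OF nz(1,2,4) generic_imp_generic_products[OF gen] that]
    by (rule eval_ratfun_eq)
  then show "P_vec n a c q t i = (\<Sum>j\<le>n. const_laurent (eval_ratfun (transition i j) a c t) * m_vec n j)"
    unfolding P_vec_eq[OF gen n] by (intro sum.cong refl) auto
qed

section \<open>Density of generic points and uniqueness\<close>

lemma countable_partitions: "countable {l. is_partition n l}"
proof (rule countable_image_inj_on)
  show "countable ((\<lambda>l. map (lkp l) [0..<Suc n]) ` {l. is_partition n l})" by simp
  show "inj_on (\<lambda>l. map (lkp l) [0..<Suc n]) {l. is_partition n l}"
  proof (rule inj_onI, rule poly_mapping_eqI)
    fix l m i
    assume lm: "l \<in> {l. is_partition n l}" "m \<in> {l. is_partition n l}"
      "map (lkp l) [0..<Suc n] = map (lkp m) [0..<Suc n]"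
    show "lkp l i = lkp m i"
    proof (cases "i \<le> n")
      case True
      then show ?thesis using lm(3) by (auto simp: map_eq_conv simp del: upt_Suc)
    next
      case False
      then have "i \<notin> Poly_Mapping.keys l" "i \<notin> Poly_Mapping.keys m"
        using lm(1,2) by (auto simp: is_partition_def)
      then show ?thesis by (simp add: in_keys_iff)
    qed
  qed
qed

lemma half_powi_inject: "(1 / 2 :: complex) powi k = (1 / 2) powi m \<Longrightarrow> k = m"
proof (rule ccontr)
  assume "(1 / 2 :: complex) powi k = (1 / 2) powi m" and "k \<noteq> m"
  then have "norm ((1 / 2 :: complex) powi k) = norm ((1 / 2 :: complex) powi m)" by simp
  then have "(1 / 2 :: real) powi k = (1 / 2) powi m" by (simp add: norm_power_int norm_divide)
  then show False
    using \<open>k \<noteq> m\<close> power_int_strict_decreasing[of k m "1/2 :: real"] power_int_strict_decreasing[of m k "1/2 :: real"]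
    by linarith
qed

lemma uncountable_obtain:
  assumes "countable (B :: complex set)"
  obtains z where "z \<notin> B"
  using assms uncountable_UNIV_complex by (metis UNIV_eq_I)

lemma finite_roots_const:
  fixes p :: "'a::idom poly poly"
  assumes "p \<noteq> 0"
  shows "finite {z. poly p [:z:] = 0}"
proof -
  have "finite ((\<lambda>z. [:z:]) -` {x. poly p x = 0})"
    by (rule finite_vimageI[OF poly_roots_finite[OF assms]]) (simp add: inj_on_def)
  then show ?thesis by (simp add: vimage_def)
qed

text \<open>Genericity is a countable family of inequations, one for each comparable pair of
  partitions. With q fixed, t, c and a are chosen in this order, each outside a countable set of
  complex numbers.\<close>

lemma exists_generic_point:
  assumes "D \<noteq> 0"
  obtains a c q t where "generic_params n a (-a) c (-c) q t" "eval_poly D a c t \<noteq> 0"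
proof -
  \<comment> \<open>For this q distinct integer exponents give distinct powers, which makes the
    polynomials \<open>A l m\<close> nonzero.\<close>
  define q :: complex where "q = 1 / 2"
  have q: "q \<noteq> 0" "norm q < 1" by (simp_all add: q_def norm_divide)
  define \<delta> where "\<delta> l m j = q powi (lkp l j) - q powi (lkp m j)" for l m :: exponent and j
  \<comment> \<open>The difference of two eigenvalues is \<open>\<alpha>\<close> times the value of
    \<open>A l m\<close> at t, plus \<open>B t l m\<close> divided by
    \<open>\<alpha>\<close>.\<close>
  define A where "A l m = (\<Sum>j=1..n. monom (\<delta> l m j) (n - j))" for l m
  define B where "B t l m = (\<Sum>j=1..n. t powi (int j - int n) * (q powi (- lkp l j) - q powi (- lkp m j)))" for t l m
  define S where "S = {(l, m). is_partition n l \<and> is_partition n m \<and> l \<noteq> m}"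
  have "countable ({l. is_partition n l} \<times> {m. is_partition n m})"
    by (intro countable_SIGMA countable_partitions)
  then have S: "countable S" by (rule countable_subset[rotated]) (auto simp: S_def)
  have A: "A l m \<noteq> 0" if "(l, m) \<in> S" for l m
  proof
    assume 0: "A l m = 0"
    have "lkp l i = lkp m i" for i
    proof (cases "i \<in> {1..n}")
      case True
      have "coeff (A l m) (n - i) = (\<Sum>j=1..n. if j = i then \<delta> l m i else 0)"
        unfolding A_def coeff_sum using True by (intro sum.cong refl) auto
      then have "\<delta> l m i = 0" using True 0 by simp
      then show ?thesis using half_powi_inject by (simp add: \<delta>_def q_def)
    next
      case False
      then have "i \<notin> Poly_Mapping.keys l" "i \<notin> Poly_Mapping.keys m"
        using that by (auto simp: S_def is_partition_def)
      then show ?thesis by (simp add: in_keys_iff)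
    qed
    then have "l = m" by (intro poly_mapping_eqI)
    then show False using that by (simp add: S_def)
  qed
  have "finite {t. poly D [:[:t:]:] = 0}"
  proof -
    have "finite ((\<lambda>z. [:[:z:]:]) -` {x. poly D x = 0})"
      by (rule finite_vimageI[OF poly_roots_finite[OF assms]]) (simp add: inj_on_def)
    then show ?thesis by (simp add: vimage_def)
  qed
  then have "countable ({0} \<union> {t. poly D [:[:t:]:] = 0} \<union> (\<Union>(l, m)\<in>S. {t. poly (A l m) t = 0}))"
    using S A by (intro countable_Un countable_UN) (auto intro: countable_finite poly_roots_finite)
  then obtain t where t: "t \<noteq> 0" "poly D [:[:t:]:] \<noteq> 0" "\<And>l m. (l, m) \<in> S \<Longrightarrow> poly (A l m) t \<noteq> 0"
    by (rule uncountable_obtain) auto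
  have "countable ({0} \<union> {c. poly (poly D [:[:t:]:]) [:c:] = 0})"
    using finite_roots_const[OF t(2)] by (intro countable_Un) (auto intro: countable_finite)
  then obtain c where c: "c \<noteq> 0" "poly (poly D [:[:t:]:]) [:c:] \<noteq> 0"
    by (rule uncountable_obtain) auto
  \<comment> \<open>Multiplying the difference of eigenvalues by \<alpha> and using \<alpha>^2 = a^2
    c^2 / q removes the square root and leaves this quadratic polynomial in a. The choices of t and
    c make its leading coefficient nonzero.\<close>
  have bad: "finite {a. poly [:B t l m, 0, c^2 / q * poly (A l m) t:] a = 0}" if "(l, m) \<in> S" for l m
    using t(3)[OF that] c(1) q(1) by (intro poly_roots_finite) auto
  have "countable ({0} \<union> {a. poly (poly (poly D [:[:t:]:]) [:c:]) a = 0} \<union>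
      (\<Union>(l, m)\<in>S. {a. poly [:B t l m, 0, c^2 / q * poly (A l m) t:] a = 0}))"
    using S bad poly_roots_finite[OF c(2)] by (intro countable_Un countable_UN) (auto intro: countable_finite)
  then obtain a where a: "a \<noteq> 0" "poly (poly (poly D [:[:t:]:]) [:c:]) a \<noteq> 0"
    "\<And>l m. (l, m) \<in> S \<Longrightarrow> poly [:B t l m, 0, c^2 / q * poly (A l m) t:] a \<noteq> 0"
    by (rule uncountable_obtain) auto
  let ?e = "koornwinder_eigenvalue n a (-a) c (-c) q t"
  define \<alpha> where "\<alpha> = alpha a (-a) c (-c) q"
  have "\<alpha>^2 = a * (-a) * c * (-c) / q" by (simp only: \<alpha>_def alpha_def power2_csqrt)
  then have \<alpha>: "\<alpha> * \<alpha> = a^2 * c^2 / q" "\<alpha> \<noteq> 0"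
    using a(1) c(1) q(1) by (auto simp: power2_eq_square)
  have "?e m \<noteq> ?e l" if "is_partition n l" "m \<in> below n l" for l m
  proof
    assume eq: "?e m = ?e l"
    have S': "(l, m) \<in> S" using that by (auto simp: S_def below_def)
    have "?e l - ?e m = \<alpha> * poly (A l m) t + inverse \<alpha> * B t l m"
      unfolding koornwinder_eigenvalue_def A_def B_def \<alpha>_def[symmetric] poly_sum sum_distrib_left
        sum.distrib[symmetric] sum_subtractf[symmetric]
      by (intro sum.cong refl) (simp add: poly_monom \<delta>_def algebra_simps)
    then have "\<alpha> * (\<alpha> * poly (A l m) t + inverse \<alpha> * B t l m) = 0" using eq by simp
    then have "\<alpha> * \<alpha> * poly (A l m) t + B t l m = 0" using \<alpha>(2) by (simp add: distrib_left mult.assoc[symmetric])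
    then have "poly [:B t l m, 0, c^2 / q * poly (A l m) t:] a = 0"
      unfolding \<alpha>(1) by (simp add: algebra_simps power2_eq_square)
    then show False using a(3)[OF S'] by contradiction
  qed
  then have "generic_params n a (-a) c (-c) q t"
    using a(1) c(1) t(1) q unfolding generic_params_def by auto
  moreover have "eval_poly D a c t \<noteq> 0" using a(2) by (simp add: eval_poly_def)
  ultimately show thesis by (rule that)
qed

text \<open>Stability speaks only of generic points where the row is regular up to index n. A
  generic point is chosen where all these denominators and also the numerator of the difference of
  the two entries are nonzero. There the coefficient of one orbit sum forces equal values, which
  contradicts the nonzero numerator.\<close>

lemma stability_imp_transition:
  assumes stab: "stability C"
  shows "C i j = transition i j"
proof (rule ccontr)
  assume neq: "C i j \<noteq> transition i j"
  define n where "n = max 1 (max i j)"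
  have n: "1 \<le> n" "i \<le> n" "j \<le> n" by (auto simp: n_def)
  have "\<exists>N D. C i k = Fract N D \<and> D \<noteq> 0" for k by (metis Fract_cases)
  then obtain N D where ND: "\<And>k. C i k = Fract (N k) (D k)" "\<And>k. D k \<noteq> 0" by metis
  obtain N0 D0 where 0: "C i j - transition i j = Fract N0 D0" "D0 \<noteq> 0" "N0 \<noteq> 0"
    using neq Fract_cases_nonzero[of "C i j - transition i j"] by auto
  have "N0 * D0 * (\<Prod>k\<le>n. D k) \<noteq> 0" using 0 ND(2) by simp
  then obtain a c q t where gen: "generic_params n a (-a) c (-c) q t"
    and ev: "eval_poly (N0 * D0 * (\<Prod>k\<le>n. D k)) a c t \<noteq> 0" by (rule exists_generic_point)
  have D: "eval_poly (D k) a c t \<noteq> 0" if "k \<le> n" for k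
  proof -
    have "(\<Prod>k\<le>n. D k) = D k * (\<Prod>k\<in>{..n} - {k}. D k)" using that by (simp add: prod.remove)
    then show ?thesis using ev by (auto simp: eval_poly_simps)
  qed
  have val: "has_value (C i k) a c t (eval_ratfun (C i k) a c t)" if "k \<le> n" for k
  proof -
    have "has_value (C i k) a c t (eval_poly (N k) a c t / eval_poly (D k) a c t)"
      unfolding ND(1) using D[OF that] by (rule has_valueI)
    then show ?thesis using eval_ratfun_eq by metis
  qed
  then have "\<forall>k\<le>n. regular_at (C i k) a c t" using regular_at_has_value by blast
  then have "P_vec n a c q t i = (\<Sum>k\<le>n. const_laurent (eval_ratfun (C i k) a c t) * m_vec n k)"
    using stab gen n(1) unfolding stability_def by blast
  then have eq: "(\<Sum>k\<le>n. const_laurent (eval_ratfun (C i k) a c t) * orbit_sum n (one_column (n - k))) =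
      (\<Sum>k\<le>n. const_laurent (catalan (recurrence_coeff a c t) i k) * orbit_sum n (one_column (n - k)))"
    unfolding P_vec_eq[OF gen n(1)] by (simp add: m_vec_def)
  note lookup = lookup_orbit_sum_combination[OF n(3)]
  have "eval_ratfun (C i j) a c t = catalan (recurrence_coeff a c t) i j"
    using lookup[of "\<lambda>k. eval_ratfun (C i k) a c t"] lookup[of "\<lambda>k. catalan (recurrence_coeff a c t) i k"]
    unfolding eq by simp
  moreover have "has_value (transition i j) a c t (catalan (recurrence_coeff a c t) i j)"
    using generic_nonzero[OF gen] by (intro has_value_transition[OF _ _ _ generic_imp_generic_products[OF gen] n(3)])
  ultimately have "has_value (C i j - transition i j) a c t 0"
    using has_value_diff[OF val[OF n(3)]] by (metis diff_self)
  moreover have "has_value (C i j - transition i j) a c t (eval_poly N0 a c t / eval_poly D0 a c t)"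
    unfolding 0 by (rule has_valueI) (use ev in \<open>auto simp: eval_poly_simps\<close>)
  ultimately have "eval_poly N0 a c t / eval_poly D0 a c t = 0" using has_value_unique by blast
  then show False using ev by (auto simp: eval_poly_simps)
qed

theorem theorem1p1:
  shows "(\<exists>!C. even_upper_triangular C \<and> stability C) \<and>
         (\<forall>C. even_upper_triangular C \<longrightarrow> (stability C \<longleftrightarrow> recursion_relations C))"
proof
  show "\<exists>!C. even_upper_triangular C \<and> stability C"
  proof (rule ex1I)
    show "even_upper_triangular transition \<and> stability transition"
      using even_upper_triangular_transition stability_transition ..
    show "C = transition" if "even_upper_triangular C \<and> stability C" for C
      using stability_imp_transition that by (intro ext) blast
  qed
  show "\<forall>C. even_upper_triangular C \<longrightarrow> (stability C \<longleftrightarrow> recursion_relations C)"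
  proof (intro allI impI iffI)
    fix C assume "stability C"
    then have "C = transition" using stability_imp_transition by (intro ext) blast
    then show "recursion_relations C" using recursion_transition by simp
  next
    fix C assume "even_upper_triangular C" "recursion_relations C"
    then have "C = transition" using recursion_imp_transition by (intro ext) blast
    then show "stability C" using stability_transition by simp
  qed
qed

end
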